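(* Let $t$ be a positive integer and $m\ge 2$ an integer. For sufficiently large $n$, the $3$-graph $\mathcal{G}(t,m,n)$ defined below contains no copy of $(t+1)\cdot\mathcal{F}_5^S(m)$ and has the maximum number of hyperedges among all $n$-vertex $3$-graphs containing no copy of $(t+1)\cdot\mathcal{F}_5^S(m)$; that is, $\mathrm{ex}_3(n,(t+1)\cdot\mathcal{F}_5^S(m))=e(\mathcal{G}(t,m,n))$.
   Context: All hypergraphs are $3$-uniform. $\mathrm{ex}_3(n,\mathcal{F})$ is the maximum number of hyperedges in an $n$-vertex $3$-graph with no copy of $\mathcal{F}$. $T_3(N,3)$ is the complete $3$-partite $3$-graph on $N$ vertices (hyperedges are triples with one vertex in each part) with part sizes $\lfloor N/3\rfloor$ or $\lceil N/3\rceil$. $\mathcal{F}_5^S(m)$ is the $3$-graph obtained from $T_3(3m,3)$ by adding one new vertex $v$ and one hyperedge consisting of $v$ and two vertices lying in the same part of $T_3(3m,3)$. $(t+1)\cdot\mathcal{F}_5^S(m)$ denotes $t+1$ vertex-disjoint copies of $\mathcal{F}_5^S(m)$. $\mathcal{G}(t,m,n)$ is the $n$-vertex $3$-graph obtained by taking a set $T$ of $t$ vertices and a disjoint copy of $T_3(n-t,3)$, and taking as hyperedges all hyperedges of $T_3(n-t,3)$ together with all triples of vertices that intersect $T$. *)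

theory Defs
  imports Complex_Main
begin

type_synonym 'a hypergraph = "'a set \<times> 'a set set"

abbreviation verts :: "'a hypergraph \<Rightarrow> 'a set" where
  "verts \<equiv> fst"

abbreviation edges :: "'a hypergraph \<Rightarrow> 'a set set" where
  "edges \<equiv> snd"

definition three_graph :: "'a hypergraph \<Rightarrow> bool" where
  "three_graph H \<longleftrightarrow>
     finite (verts H) \<and> (\<forall>e\<in>edges H. e \<subseteq> verts H \<and> card e = 3)"

text \<open>A copy of \<open>F\<close> is a not necessarily induced subhypergraph isomorphic to \<open>F\<close>.\<close>

definition contains_copy :: "'a hypergraph \<Rightarrow> 'b hypergraph \<Rightarrow> bool" where
  "contains_copy H F \<longleftrightarrow>
     (\<exists>f. inj_on f (verts F) \<and> f ` verts F \<subseteq> verts H \<and> (\<forall>e\<in>edges F. f ` e \<in> edges H))"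

text \<open>
  Vertices are natural numbers, which loses no generality for finite hypergraphs.
  The set of edge counts is bounded by \<open>n choose 3\<close>; it is nonempty, so that
  \<open>Max\<close> is meaningful, whenever \<open>F\<close> has an edge.
\<close>

definition ex3 :: "nat \<Rightarrow> 'b hypergraph \<Rightarrow> nat" where
  "ex3 n F = Max {card (edges H) | H :: nat hypergraph.
     three_graph H \<and> card (verts H) = n \<and> \<not> contains_copy H F}"

text \<open>The three parts of \<open>{..<N}\<close> are the residue classes modulo 3.\<close>

definition part :: "nat \<Rightarrow> nat \<Rightarrow> nat set" where
  "part N i = {x. x < N \<and> x mod 3 = i}"

definition turan3 :: "nat \<Rightarrow> nat hypergraph" where
  "turan3 N = ({..<N},
     {{x, y, z} | x y z. x \<in> part N 0 \<and> y \<in> part N 1 \<and> z \<in> part N 2})"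

text \<open>
  The new vertex is \<open>3 * m\<close>. The vertices 0 and 3 lie in the same part of
  \<open>turan3 (3 * m)\<close> provided \<open>m \<ge> 2\<close>; any other pair inside a part
  gives an isomorphic hypergraph.
\<close>

definition F5S :: "nat \<Rightarrow> nat hypergraph" where
  "F5S m = (insert (3 * m) (verts (turan3 (3 * m))),
            insert {3 * m, 0, 3} (edges (turan3 (3 * m))))"

definition disjoint_copies :: "nat \<Rightarrow> 'a hypergraph \<Rightarrow> (nat \<times> 'a) hypergraph" where
  "disjoint_copies k H = ({..<k} \<times> verts H, {Pair i ` e | i e. i < k \<and> e \<in> edges H})"

text \<open>
  The \<open>t\<close> vertices \<open>{n - t..<n}\<close> play the role of \<open>T\<close>
  (for \<open>n \<ge> t\<close>). The construction does not depend on \<open>m\<close>.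
\<close>

definition extremal_graph :: "nat \<Rightarrow> nat \<Rightarrow> nat hypergraph" where
  "extremal_graph t n = ({..<n},
     edges (turan3 (n - t)) \<union>
     {e. e \<subseteq> {..<n} \<and> card e = 3 \<and> e \<inter> {n - t..<n} \<noteq> {}})"

lemma card_part:
  assumes "i < 3"
  shows "card (part N i) = (N + 2 - i) div 3"
proof (induction N)
  case 0
  show ?case using assms by (simp add: part_def)
next
  case (Suc N)
  have fin: "finite (part N i)" and notin: "N \<notin> part N i"
    by (simp_all add: part_def)
  have "part (Suc N) i = (if N mod 3 = i then insert N (part N i) else part N i)"
    by (auto simp: part_def less_Suc_eq)
  then have "card (part (Suc N) i) = (if N mod 3 = i then Suc else id) ((N + 2 - i) div 3)"
    using Suc fin notin by simp
  also have "\<dots> = (Suc N + 2 - i) div 3"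
  proof -
    have i: "i = 0 \<or> i = 1 \<or> i = 2" using assms by linarith
    have "N = 3 * (N div 3) + N mod 3" "N mod 3 < 3" by simp_all
    then obtain q r where "N = 3 * q + r" and "r < 3" by blast
    then have "N = 3 * q \<or> N = 3 * q + 1 \<or> N = 3 * q + 2" by linarith
    with i show ?thesis by (elim disjE; simp; arith?)
  qed
  finally show ?case .
qed

lemma part_balanced:
  assumes "i < 3"
  shows "int (card (part N i)) \<in> {\<lfloor>real N / 3\<rfloor>, \<lceil>real N / 3\<rceil>}"
proof -
  have "\<lfloor>real N / 3\<rfloor> = int (N div 3)"
    using floor_divide_of_nat_eq[of N 3] by simp
  moreover have "\<lceil>real N / 3\<rceil> = int ((N + 2) div 3)"
    by (rule ceiling_unique) linarith+
  moreover have "(N + 2 - i) div 3 = N div 3 \<or> (N + 2 - i) div 3 = (N + 2) div 3"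
  proof -
    have "i = 0 \<or> i = 1 \<or> i = 2" using assms by auto
    then show ?thesis by (elim disjE; simp; linarith)
  qed
  ultimately show ?thesis
    using card_part[OF assms] by auto
qed

lemma three_graph_turan3: "three_graph (turan3 N)"
  unfolding three_graph_def
proof (intro conjI ballI)
  show "finite (verts (turan3 N))" by (simp add: turan3_def)
next
  fix e assume "e \<in> edges (turan3 N)"
  then obtain x y z where e: "e = {x, y, z}"
    and "x \<in> part N 0" "y \<in> part N 1" "z \<in> part N 2"
    unfolding turan3_def snd_conv by blast
  then have lt: "x < N" "y < N" "z < N" and md: "x mod 3 = 0" "y mod 3 = 1" "z mod 3 = 2"
    unfolding part_def by blast+
  show "e \<subseteq> verts (turan3 N)"
    using lt by (simp add: e turan3_def)
  have "x \<noteq> y" "x \<noteq> z" "y \<noteq> z"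
    using md by (metis zero_neq_one zero_neq_numeral one_eq_numeral_iff semiring_norm(83))+
  then show "card e = 3" by (simp add: e)
qed

lemma three_graph_F5S:
  assumes "m \<ge> 2"
  shows "three_graph (F5S m)"
proof -
  have "card {3 * m, 0, 3} = 3" using assms by simp
  moreover have "{3 * m, 0, 3} \<subseteq> insert (3 * m) (verts (turan3 (3 * m)))"
    using assms by (simp add: turan3_def)
  ultimately show ?thesis
    using three_graph_turan3[of "3 * m"]
    unfolding three_graph_def F5S_def fst_conv snd_conv by blast
qed

lemma three_graph_extremal_graph: "three_graph (extremal_graph t n)"
proof -
  have "e \<subseteq> {..<n} \<and> card e = 3" if "e \<in> edges (turan3 (n - t))" for e
  proof -
    have "e \<subseteq> verts (turan3 (n - t))" "card e = 3"
      using three_graph_turan3[of "n - t"] that unfolding three_graph_def by blast+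
    moreover have "verts (turan3 (n - t)) \<subseteq> {..<n}" by (auto simp: turan3_def)
    ultimately show ?thesis by blast
  qed
  then show ?thesis
    unfolding three_graph_def extremal_graph_def fst_conv snd_conv by blast
qed

lemma card_verts_extremal_graph: "card (verts (extremal_graph t n)) = n"
  by (simp add: extremal_graph_def)

end

(*
  If two vertices c, d lie in a common edge and their links share a positive proportion of all
  pairs, then (after discarding pairs of small codegree) the common links contain a complete
  tripartite graph, which together with the edge through c and d is a copy of F5S m. So in a
  graph without copies, vertices covered by an edge have almost disjoint links. Call two vertices
  adjacent if they are covered by an edge. For an edge xyz, few neighbours of z lie in the
  common neighbourhood N(xy), so D(z) + d(xy) <= n up to small errors, where D counts neighbours
  and d codegrees. Summing over all edges and using Cauchy-Schwarz on each link gives density at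
  most 2/9; near equality some edge uvw has d(uv) + d(vw) + d(uw) close to n, and the sets N(uv),
  N(vw), N(uw), almost disjoint and almost independent, are the desired tripartition.

  For the exact result take a colouring with the maximum number of transversal edges. A vertex in
  many non-transversal edges lies in copies avoiding any bounded set, so there are s <= t of
  them. Delete these, together with a maximal packing in the rest: each remaining non-transversal
  edge contains a vertex missing quadratically many transversal triples, so non-transversal edges
  are at most as many as missing triples. If s < t, the edges through t - s further full-degree
  vertices of the extremal graph outweigh the edges lost to the packing.
*)

theory Submission
  imports Defs "HOL-Analysis.Convex"
begin

section \<open>Complete tripartite subgraphs\<close>

text \<open>Densities are counted over ordered triples, so 2/9 = 6/27 is the balanced tripartite
  value. Let L(z) count the ordered pairs in the link of z, and let s(z) be the sum of d(xz)^2 over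
  x. Summing D + d <= n over edges gives sum L D + sum d^2 <= n total up to errors, but
  Cauchy-Schwarz only yields L^2 <= D s, which is not linear. It is replaced by its tangent at the
  tripartite values; then D can be eliminated and sum d^2 >= n total - 4 n^4 / 27. The average of
  d(uv) + d(vw) + d(uw) over edges is then at least 3 n - (4/9) n^4 / total, which reaches n exactly
  at total = 2 n^3 / 9. This is why one edge reveals the tripartition. In the exact part maximality
  of the colouring is used only by moving a single vertex: a vertex with many non-transversal edges
  must then have many transversal ones as well. The edge count is compared with the extremal graph
  on s special vertices; each further special vertex is worth at least n^2 / 16 edges, each packed
  copy costs at most (3 m + 1) \<open>\<mu>\<close> n^2, and \<open>\<mu>\<close> is chosen to make
  the cost smaller.\<close>

lemma common_neighbours_aux:
  fixes R :: "'p \<Rightarrow> 'a \<Rightarrow> bool" and \<delta> :: real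
  assumes "finite P" "finite V" "0 < \<delta>" "\<delta> \<le> 1"
    and deg: "\<And>p. p \<in> P \<Longrightarrow> \<delta> * card V \<le> card {v \<in> V. R p v}"
  shows "2 * real m \<le> \<delta> * card V \<Longrightarrow>
    \<exists>S\<subseteq>V. card S = m \<and> (\<delta> / 2) ^ m * card P \<le> card {p \<in> P. \<forall>v\<in>S. R p v}"
proof (induction m)
  case 0
  show ?case by (intro exI[of _ "{}"]) simp
next
  case (Suc m)
  then obtain S where S: "S \<subseteq> V" "card S = m"
    and big: "(\<delta> / 2) ^ m * card P \<le> card {p \<in> P. \<forall>v\<in>S. R p v}"
    by auto
  define Q where "Q = {p \<in> P. \<forall>v\<in>S. R p v}"
  have finQ: "finite Q" and finS: "finite S" using assms S by (auto simp: Q_def intro: finite_subset)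
  have "real m < card V"
  proof -
    have "\<delta> * card V \<le> card V" using assms by (simp add: mult_left_le_one_le)
    then show ?thesis using Suc.prems by simp
  qed
  then have ne: "V - S \<noteq> {}" using S finS
    by (metis Diff_eq_empty_iff card_mono leD of_nat_less_iff)
  \<comment> \<open>Averaging: \<open>S\<close> occupies at most half of the
    \<open>\<delta> * card V\<close> neighbours of each \<open>p\<close>, so every \<open>p\<close>
    in \<open>Q\<close> keeps a \<open>\<delta> / 2\<close> share of \<open>V\<close> outside
    \<open>S\<close>.\<close>
  have "\<exists>v\<in>V - S. \<delta> / 2 * card Q \<le> card {p \<in> Q. R p v}"
  proof (rule ccontr)
    assume "\<not> ?thesis"
    then have "(\<Sum>v\<in>V - S. real (card {p \<in> Q. R p v})) < (\<Sum>v\<in>V - S. \<delta> / 2 * card Q)"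
      using ne assms(2) by (intro sum_strict_mono) (auto simp: not_le)
    also have "\<dots> \<le> \<delta> / 2 * card Q * card V"
    proof -
      have "real (card (V - S)) \<le> card V" using assms(2) by (simp add: card_mono)
      then have "\<delta> / 2 * card Q * card (V - S) \<le> \<delta> / 2 * card Q * card V"
        using assms(3) by (intro mult_left_mono) auto
      then show ?thesis by (simp add: mult_ac)
    qed
    also have "\<dots> = (\<Sum>p\<in>Q. \<delta> / 2 * card V)" by simp
    also have "\<dots> \<le> (\<Sum>p\<in>Q. real (card {v \<in> V - S. R p v}))"
    proof (rule sum_mono)
      fix p assume "p \<in> Q"
      then have "\<delta> * card V \<le> card {v \<in> V. R p v}" using deg by (simp add: Q_def)
      also have "{v \<in> V. R p v} \<subseteq> {v \<in> V - S. R p v} \<union> S" by auto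
      then have "card {v \<in> V. R p v} \<le> card ({v \<in> V - S. R p v} \<union> S)"
        using assms(2) finS by (intro card_mono) auto
      then have "real (card {v \<in> V. R p v}) \<le> card {v \<in> V - S. R p v} + real m"
        using card_Un_le[of "{v \<in> V - S. R p v}" S] S(2) by linarith
      finally show "\<delta> / 2 * card V \<le> card {v \<in> V - S. R p v}"
        using Suc.prems by simp
    qed
    also have "\<dots> = (\<Sum>v\<in>V - S. real (card {p \<in> Q. R p v}))"
      using sum.swap_restrict[OF finQ, of "V - S" "\<lambda>_ _. 1::real" R] assms(2) by simp
    finally show False by simp
  qed
  then obtain v where v: "v \<in> V - S" "\<delta> / 2 * card Q \<le> card {p \<in> Q. R p v}" by blast
  have "{p \<in> P. \<forall>u\<in>insert v S. R p u} = {p \<in> Q. R p v}" by (auto simp: Q_def)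
  moreover have "(\<delta> / 2) ^ Suc m * card P \<le> card {p \<in> Q. R p v}"
  proof -
    have "(\<delta> / 2) ^ Suc m * card P = \<delta> / 2 * ((\<delta> / 2) ^ m * card P)" by simp
    also have "\<dots> \<le> \<delta> / 2 * card Q"
      using big assms(3) unfolding Q_def by (intro mult_left_mono) auto
    finally show ?thesis using v by linarith
  qed
  ultimately show ?case
    using v S finS by (intro exI[of _ "insert v S"]) auto
qed

text \<open>Only the average degree is large here. Restricting to the \<open>p\<close> with degree
  at least \<open>\<delta> / 2 * card V\<close> keeps a \<open>\<delta> / 2\<close> share of
  \<open>P\<close>; the greedy choice then halves the density once more, to
  \<open>\<delta> / 4\<close>.\<close>

lemma common_neighbours:
  fixes R :: "'p \<Rightarrow> 'a \<Rightarrow> bool" and \<delta> :: real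
  assumes "finite P" "finite V" "0 < \<delta>" "\<delta> \<le> 1"
    and dens: "\<delta> * card P * card V \<le> (\<Sum>p\<in>P. real (card {v \<in> V. R p v}))"
    and large: "4 * real m \<le> \<delta> * card V" "V \<noteq> {}"
  shows "\<exists>S\<subseteq>V. card S = m \<and> (\<delta> / 4) ^ Suc m * card P \<le> card {p \<in> P. \<forall>v\<in>S. R p v}"
proof -
  define Q where "Q = {p \<in> P. \<delta> / 2 * card V \<le> card {v \<in> V. R p v}}"
  have finQ: "finite Q" and sub: "Q \<subseteq> P" using assms by (auto simp: Q_def)
  have n: "real (card V) > 0" using assms by (simp add: card_gt_0_iff)
  have "(\<Sum>p\<in>P. real (card {v \<in> V. R p v})) \<le> (\<Sum>p\<in>P. \<delta> / 2 * card V + (if p \<in> Q then real (card V) else 0))"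
    using assms(2,3) by (intro sum_mono) (auto simp: Q_def card_mono add_increasing)
  also have "\<dots> = card P * (\<delta> / 2 * card V) + card Q * card V"
  proof -
    have "(\<Sum>p\<in>P. if p \<in> Q then real (card V) else 0) = card Q * card V"
      using assms(1) sub by (simp add: sum.If_cases Int_absorb1)
    then show ?thesis by (simp add: sum.distrib)
  qed
  finally have "\<delta> / 2 * card P * card V \<le> card Q * card V" using dens by (simp add: algebra_simps)
  then have Q: "\<delta> / 2 * card P \<le> card Q" using n by simp
  obtain S where S: "S \<subseteq> V" "card S = m"
    and big: "(\<delta> / 2 / 2) ^ m * card Q \<le> card {p \<in> Q. \<forall>v\<in>S. R p v}"
    using common_neighbours_aux[OF finQ assms(2), of "\<delta> / 2" R m] assms Q_def by auto
  have "(\<delta> / 4) ^ Suc m * card P \<le> (\<delta> / 4) ^ m * (\<delta> / 2 * card P)"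
    using assms(3) by (simp add: mult_mono' field_simps)
  also have "\<dots> \<le> (\<delta> / 4) ^ m * card Q" using Q assms(3) by (intro mult_left_mono) auto
  also have "\<dots> \<le> card {p \<in> Q. \<forall>v\<in>S. R p v}" using big by simp
  also have "\<dots> \<le> card {p \<in> P. \<forall>v\<in>S. R p v}"
    using assms(1) sub by (auto intro!: card_mono)
  finally show ?thesis using S by blast
qed

lemma sum_card_fibres:
  assumes "finite A" "finite B" "R \<subseteq> A \<times> B"
  shows "(\<Sum>p\<in>A. card {v \<in> B. (p, v) \<in> R}) = card R"
proof -
  have "R = (SIGMA p:A. {v \<in> B. (p, v) \<in> R})" using assms by auto
  then have "card R = card (SIGMA p:A. {v \<in> B. (p, v) \<in> R})" by simp
  also have "\<dots> = (\<Sum>p\<in>A. card {v \<in> B. (p, v) \<in> R})" using assms by (simp add: card_SigmaI)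
  finally show ?thesis by simp
qed

text \<open>Fixing \<open>m\<close> third coordinates leaves a dense set of pairs, and fixing
  \<open>m\<close> second coordinates leaves linearly many first ones. The three sets may overlap;
  in the application disjointness follows because related points form an edge of three distinct
  vertices.\<close>

lemma complete_tripartite_exists:
  fixes \<delta> :: real
  assumes "0 < \<delta>"
  shows "\<exists>n0. \<forall>V :: 'a set. \<forall>R. finite V \<and> n0 \<le> card V \<and> R \<subseteq> (V \<times> V) \<times> V \<and> \<delta> * card V ^ 3 \<le> card R \<longrightarrow>
    (\<exists>A B C. A \<subseteq> V \<and> B \<subseteq> V \<and> C \<subseteq> V \<and> card A = m \<and> card B = m \<and> card C = m \<and> (A \<times> B) \<times> C \<subseteq> R)"
proof -
  define \<delta>0 where "\<delta>0 = min \<delta> 1"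
  define \<delta>1 where "\<delta>1 = (\<delta>0 / 4) ^ Suc m"
  define \<delta>2 where "\<delta>2 = (\<delta>1 / 4) ^ Suc m"
  have p0: "0 < \<delta>0" "\<delta>0 \<le> 1" using assms by (auto simp: \<delta>0_def)
  then have p1: "0 < \<delta>1" "\<delta>1 \<le> 1" unfolding \<delta>1_def by (auto intro!: power_le_one simp del: power_Suc)
  then have p2: "0 < \<delta>2" unfolding \<delta>2_def by (auto simp del: power_Suc)
  obtain n0 :: nat where n0: "n0 \<ge> 1" "4 * real m / \<delta>0 \<le> n0" "4 * real m / \<delta>1 \<le> n0" "m / \<delta>2 \<le> n0"
  proof -
    obtain k where "max (4 * real m / \<delta>0) (max (4 * real m / \<delta>1) (m / \<delta>2)) \<le> real k"
      using real_arch_simple by blast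
    then show ?thesis by (intro that[of "Suc k"]) auto
  qed
  show ?thesis
  proof (intro exI[of _ n0] allI impI, elim conjE)
    fix V :: "'a set" and R
    assume fin: "finite V" and n: "n0 \<le> card V" and R: "R \<subseteq> (V \<times> V) \<times> V"
      and big: "\<delta> * card V ^ 3 \<le> card R"
    have ne: "V \<noteq> {}" using n n0 by auto
    have n': "real n0 \<le> card V" using n by simp
    have l0: "4 * real m \<le> \<delta>0 * card V"
      using n0(2) n' p0 by (smt (verit) mult.commute pos_divide_le_eq)
    have l1: "4 * real m \<le> \<delta>1 * card V"
      using n0(3) n' p1 by (smt (verit) mult.commute pos_divide_le_eq)
    have l2: "real m \<le> \<delta>2 * card V"
      using n0(4) n' p2 by (smt (verit) mult.commute pos_divide_le_eq)
    have "\<delta>0 * card (V \<times> V) * card V \<le> \<delta> * card V ^ 3"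
      by (auto simp: \<delta>0_def card_cartesian_product power3_eq_cube mult.assoc intro!: mult_right_mono)
    also have "\<dots> \<le> card R" by (rule big)
    also have "real (card R) = (\<Sum>p\<in>V \<times> V. real (card {v \<in> V. (p, v) \<in> R}))"
      using sum_card_fibres[OF _ fin R] fin by (simp flip: of_nat_sum)
    finally obtain C where C: "C \<subseteq> V" "card C = m"
      and c: "\<delta>1 * card (V \<times> V) \<le> card {p \<in> V \<times> V. \<forall>v\<in>C. (p, v) \<in> R}"
      using common_neighbours[OF _ fin p0, of "V \<times> V" "\<lambda>p v. (p, v) \<in> R" m] l0 ne fin
      unfolding \<delta>1_def by blast
    define R1 where "R1 = {p \<in> V \<times> V. \<forall>v\<in>C. (p, v) \<in> R}"
    have "\<delta>1 * card V * card V \<le> card R1"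
      using c by (simp add: R1_def card_cartesian_product mult.assoc)
    also have "real (card R1) = (\<Sum>p\<in>V. real (card {v \<in> V. (p, v) \<in> R1}))"
      using sum_card_fibres[OF fin fin, of R1] by (simp add: R1_def flip: of_nat_sum)
    finally obtain B where B: "B \<subseteq> V" "card B = m"
      and b: "\<delta>2 * card V \<le> card {p \<in> V. \<forall>v\<in>B. (p, v) \<in> R1}"
      using common_neighbours[OF fin fin p1, of "\<lambda>p v. (p, v) \<in> R1" m] l1 ne
      unfolding \<delta>2_def by blast
    have "m \<le> card {p \<in> V. \<forall>v\<in>B. (p, v) \<in> R1}" using l2 b by linarith
    then obtain A where A: "A \<subseteq> {p \<in> V. \<forall>v\<in>B. (p, v) \<in> R1}" "card A = m"
      by (elim obtain_subset_with_card_n)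
    have "(A \<times> B) \<times> C \<subseteq> R" using A by (auto simp: R1_def)
    then show "\<exists>A B C. A \<subseteq> V \<and> B \<subseteq> V \<and> C \<subseteq> V \<and> card A = m \<and> card B = m \<and> card C = m \<and> (A \<times> B) \<times> C \<subseteq> R"
      using A B C by blast
  qed
qed

section \<open>Copies and packings\<close>

text \<open>The copy is remembered only through its vertex set \<open>U\<close>, so that avoiding a
  set and being disjoint from other copies become plain statements about sets.\<close>

definition is_copy :: "'b hypergraph \<Rightarrow> 'a set set \<Rightarrow> 'a set \<Rightarrow> bool" where
  "is_copy F E U \<longleftrightarrow> (\<exists>f. inj_on f (verts F) \<and> f ` verts F = U \<and> (\<forall>e\<in>edges F. f ` e \<in> E))"

definition packing :: "'b hypergraph \<Rightarrow> 'a set set \<Rightarrow> nat \<Rightarrow> (nat \<Rightarrow> 'a set) \<Rightarrow> bool" where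
  "packing F E k U \<longleftrightarrow>
     (\<forall>i<k. is_copy F E (U i)) \<and> (\<forall>i<k. \<forall>j<k. i \<noteq> j \<longrightarrow> U i \<inter> U j = {})"

lemma contains_disjoint_copies_iff:
  "contains_copy H (disjoint_copies k F) \<longleftrightarrow>
     (\<exists>U. packing F (edges H) k U \<and> (\<forall>i<k. U i \<subseteq> verts H))"
proof
  assume "contains_copy H (disjoint_copies k F)"
  then obtain f where f: "inj_on f ({..<k} \<times> verts F)" "f ` ({..<k} \<times> verts F) \<subseteq> verts H"
    and e': "\<forall>e\<in>{Pair i ` e | i e. i < k \<and> e \<in> edges F}. f ` e \<in> edges H"
    unfolding contains_copy_def disjoint_copies_def fst_conv snd_conv by (elim exE conjE)
  have e: "f ` Pair i ` e \<in> edges H" if "i < k" "e \<in> edges F" for i e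
    using that by (intro bspec[OF e']) blast
  define U where "U i = f ` Pair i ` verts F" for i
  have "is_copy F (edges H) (U i)" if "i < k" for i
    unfolding is_copy_def
  proof (intro exI conjI ballI)
    show "inj_on (f \<circ> Pair i) (verts F)"
      using f(1) that by (auto simp: inj_on_def)
    show "(f \<circ> Pair i) ` verts F = U i" by (simp add: U_def image_comp)
    show "(f \<circ> Pair i) ` e \<in> edges H" if "e \<in> edges F" for e
      using e[OF \<open>i < k\<close> that] by (simp add: image_comp)
  qed
  moreover have "U i \<inter> U j = {}" if "i < k" "j < k" "i \<noteq> j" for i j
    using f(1) that by (fastforce simp: U_def inj_on_def)
  moreover have "U i \<subseteq> verts H" if "i < k" for i
    using f(2) that by (auto simp: U_def)
  ultimately show "\<exists>U. packing F (edges H) k U \<and> (\<forall>i<k. U i \<subseteq> verts H)"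
    unfolding packing_def by blast
next
  assume "\<exists>U. packing F (edges H) k U \<and> (\<forall>i<k. U i \<subseteq> verts H)"
  then obtain U where U: "\<And>i. i < k \<Longrightarrow> is_copy F (edges H) (U i)"
    and disj: "\<And>i j. i < k \<Longrightarrow> j < k \<Longrightarrow> i \<noteq> j \<Longrightarrow> U i \<inter> U j = {}"
    and sub: "\<And>i. i < k \<Longrightarrow> U i \<subseteq> verts H"
    unfolding packing_def by blast
  have "\<forall>i. \<exists>f. i < k \<longrightarrow> inj_on f (verts F) \<and> f ` verts F = U i \<and> (\<forall>e\<in>edges F. f ` e \<in> edges H)"
    using U unfolding is_copy_def by blast
  then obtain f where f: "\<And>i. i < k \<Longrightarrow>
      inj_on (f i) (verts F) \<and> f i ` verts F = U i \<and> (\<forall>e\<in>edges F. f i ` e \<in> edges H)"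
    by metis
  define h where "h = (\<lambda>(i, x). f i x)"
  have "inj_on h ({..<k} \<times> verts F)"
  proof (rule inj_onI, clarsimp simp: h_def)
    fix i x j y assume a: "i < k" "x \<in> verts F" "j < k" "y \<in> verts F" "f i x = f j y"
    have "f i x \<in> U i" "f j y \<in> U j" using f a by blast+
    then have "i = j" using disj a by (metis disjoint_iff)
    moreover have "x = y" using f a \<open>i = j\<close> by (metis inj_onD)
    ultimately show "i = j \<and> x = y" by simp
  qed
  moreover have "h ` ({..<k} \<times> verts F) \<subseteq> verts H"
    using f sub by (fastforce simp: h_def)
  moreover have "h ` Pair i ` e \<in> edges H" if "i < k" "e \<in> edges F" for i e
    using f that by (simp add: h_def image_image)
  ultimately show "contains_copy H (disjoint_copies k F)"
    unfolding contains_copy_def disjoint_copies_def fst_conv snd_conv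
    by (intro exI[of _ h]) auto
qed

lemma card_F5S_verts: "card (verts (F5S m)) = 3 * m + 1"
  by (simp add: F5S_def turan3_def)

lemma card_copy_F5S: "is_copy (F5S m) E U \<Longrightarrow> card U = 3 * m + 1"
  unfolding is_copy_def using card_image card_F5S_verts by metis

text \<open>\<open>C\<close> plays residue class 0, which contains the vertices 0 and 3 of the extra
  edge; \<open>A\<close> and \<open>B\<close> play classes 1 and 2, and \<open>e\<close> is the
  image of the new vertex \<open>3 * m\<close>.\<close>

lemma F5S_copyI:
  assumes "2 \<le> m" "{c, d, e} \<in> E" "c \<noteq> d"
    and triples: "\<And>a b x. a \<in> A \<Longrightarrow> b \<in> B \<Longrightarrow> x \<in> C \<Longrightarrow> {a, b, x} \<in> E"
    and C: "c \<in> C" "d \<in> C" and card: "card A = m" "card B = m" "card C = m"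
    and disj: "A \<inter> B = {}" "A \<inter> C = {}" "B \<inter> C = {}" "e \<notin> A \<union> B \<union> C"
  shows "is_copy (F5S m) E (insert e (A \<union> B \<union> C))"
proof -
  define S where "S i = (if i = 0 then C else if i = 1 then A else B)" for i :: nat
  have cardS: "card (S i) = m" for i using card by (simp add: S_def)
  then have finS: "finite (S i)" for i using assms(1) by (intro card_ge_0_finite) simp
  have "card (C - {c, d}) = m - 2"
    using C card assms(3) finS[of 0] by (simp add: S_def card_Diff_subset)
  then obtain h where h: "bij_betw h {2..<m} (C - {c, d})"
    using ex_bij_betw_nat_finite_1 finS[of 0]
    by (metis S_def card_atLeastLessThan finite_Diff finite_atLeastLessThan finite_same_card_bij)
  obtain \<alpha> where \<alpha>: "bij_betw \<alpha> {0..<m} A"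
    using ex_bij_betw_nat_finite[OF finS[of 1]] card by (auto simp: S_def)
  obtain \<beta> where \<beta>: "bij_betw \<beta> {0..<m} B"
    using ex_bij_betw_nat_finite[OF finS[of 2]] card by (auto simp: S_def)
  \<comment> \<open>Vertex \<open>v\<close> will be sent to entry \<open>v div 3\<close> of class
    \<open>v mod 3\<close>, so 0 and 3 are entries 0 and 1 of class 0 and must become
    \<open>c\<close> and \<open>d\<close>.\<close>
  define \<gamma> where "\<gamma> k = (if k = 0 then c else if k = 1 then d else h k)" for k :: nat
  have \<gamma>: "bij_betw \<gamma> {0..<m} C"
  proof -
    have "bij_betw \<gamma> {2..<m} (C - {c, d})"
      by (rule bij_betw_cong[THEN iffD1, OF _ h]) (simp add: \<gamma>_def)
    moreover have "bij_betw \<gamma> {0, 1} {c, d}"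
      using assms(3) by (auto simp: bij_betw_def \<gamma>_def)
    ultimately have "bij_betw \<gamma> ({0, 1} \<union> {2..<m}) ({c, d} \<union> (C - {c, d}))"
      by (intro bij_betw_combine) auto
    moreover have "{0, 1} \<union> {2..<m} = {0..<m}" using assms(1) by auto
    moreover have "{c, d} \<union> (C - {c, d}) = C" using C by auto
    ultimately show ?thesis by simp
  qed
  define \<phi> where "\<phi> i = (if i = 0 then \<gamma> else if i = 1 then \<alpha> else \<beta>)" for i :: nat
  have \<phi>: "bij_betw (\<phi> i) {0..<m} (S i)" for i
    using \<alpha> \<beta> \<gamma> by (simp add: \<phi>_def S_def)
  define f where "f v = (if v = 3 * m then e else \<phi> (v mod 3) (v div 3))" for v
  have fS: "f v \<in> S (v mod 3)" if "v < 3 * m" for v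
    using \<phi>[of "v mod 3"] that by (auto simp: f_def bij_betw_def)
  have Sdisj: "S i \<inter> S j = {}" if "i < 3" "j < 3" "i \<noteq> j" for i j
    using that disj by (auto simp: S_def)
  have eS: "e \<notin> S i" for i using disj by (simp add: S_def)
  have verts: "verts (F5S m) = insert (3 * m) {..<3 * m}" by (simp add: F5S_def turan3_def)
  have "inj_on f {..<3 * m}"
  proof (rule inj_onI)
    fix v w assume vw: "v \<in> {..<3 * m}" "w \<in> {..<3 * m}" "f v = f w"
    then have "f v \<in> S (v mod 3) \<inter> S (w mod 3)" using fS[of v] fS[of w] by simp
    then have md: "v mod 3 = w mod 3" using Sdisj[of "v mod 3" "w mod 3"] by auto
    moreover have "v div 3 = w div 3"
      using vw md \<phi>[of "w mod 3"] by (auto simp: f_def bij_betw_def dest: inj_onD)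
    ultimately show "v = w" by (metis div_mult_mod_eq)
  qed
  moreover have "f (3 * m) \<notin> f ` {..<3 * m}"
    using fS eS by (fastforce simp: f_def)
  ultimately have inj: "inj_on f (verts (F5S m))" by (simp add: verts)
  have "f ` {..<3 * m} = A \<union> B \<union> C"
  proof (rule card_seteq[symmetric, THEN sym])
    show "finite (A \<union> B \<union> C)" using finS[of 0] finS[of 1] finS[of 2] by (simp add: S_def)
    show "f ` {..<3 * m} \<subseteq> A \<union> B \<union> C" using fS by (fastforce simp: S_def split: if_splits)
    have "card (f ` {..<3 * m}) = 3 * m" using \<open>inj_on f {..<3 * m}\<close> by (simp add: card_image)
    moreover have "card (A \<union> B \<union> C) \<le> card A + card B + card C"
      by (meson card_Un_le add_le_mono1 order_trans)
    ultimately show "card (A \<union> B \<union> C) \<le> card (f ` {..<3 * m})" using card by simp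
  qed
  moreover have fe: "f (3 * m) = e" by (simp add: f_def)
  ultimately have img: "f ` verts (F5S m) = insert e (A \<union> B \<union> C)" by (simp add: verts)
  have "f ` X \<in> E" if X_edge: "X \<in> edges (F5S m)" for X
  proof -
    consider "X = {3 * m, 0, 3}" | "X \<in> edges (turan3 (3 * m))" using X_edge by (auto simp: F5S_def)
    then show ?thesis
    proof cases
      case 1
      have "f 0 = c" "f 3 = d" using assms(1) by (auto simp: f_def \<phi>_def \<gamma>_def)
      then have "f ` X = {c, d, e}" using 1 fe by auto
      then show ?thesis using assms by simp
    next
      case 2
      then obtain x y z where X: "X = {x, y, z}"
        and p: "x \<in> part (3 * m) 0" "y \<in> part (3 * m) 1" "z \<in> part (3 * m) 2"
        unfolding turan3_def snd_conv by blast
      have "f x \<in> C" "f y \<in> A" "f z \<in> B"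
        using fS[of x] fS[of y] fS[of z] p by (auto simp: part_def S_def)
      then have "{f y, f z, f x} \<in> E" using triples by blast
      moreover have "f ` X = {f y, f z, f x}" using X by auto
      ultimately show ?thesis by simp
    qed
  qed
  with inj img show ?thesis unfolding is_copy_def by blast
qed

lemma card_3_distinct: "card {x, y, z} = 3 \<Longrightarrow> x \<noteq> y \<and> y \<noteq> z \<and> x \<noteq> z"
  by (auto simp: card_insert_if split: if_splits)

text \<open>A pair in both links treats \<open>c\<close> and \<open>d\<close> like any third vertex
  \<open>x\<close>. Hence, in a complete tripartite family of such triples, two vertices of the
  third class can be exchanged for \<open>c\<close> and \<open>d\<close>, and
  \<open>{c, d, e}\<close> is the extra edge. Avoiding \<open>W\<close> and the edge itself costs
  only quadratically many triples.\<close>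

lemma copy_from_common_links:
  fixes \<delta> :: real and K m :: nat
  assumes "0 < \<delta>" "2 \<le> m"
  shows "\<exists>n0. \<forall>V :: 'a set. \<forall>E W c d e. finite V \<and> n0 \<le> card V \<and> (\<forall>X\<in>E. card X = 3) \<and>
    {c, d, e} \<in> E \<and> {c, d, e} \<subseteq> V - W \<and> W \<subseteq> V \<and> card W \<le> K \<and>
    \<delta> * card V ^ 3 \<le> card {((a, b), x) \<in> (V \<times> V) \<times> V. {a, b, c} \<in> E \<and> {a, b, d} \<in> E \<and> {a, b, x} \<in> E} \<longrightarrow>
    (\<exists>U\<subseteq>V - W. is_copy (F5S m) E U)"
proof -
  obtain n1 where n1: "\<forall>V :: 'a set. \<forall>R. finite V \<and> n1 \<le> card V \<and> R \<subseteq> (V \<times> V) \<times> V \<and>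
      \<delta> / 2 * card V ^ 3 \<le> card R \<longrightarrow>
    (\<exists>A B C. A \<subseteq> V \<and> B \<subseteq> V \<and> C \<subseteq> V \<and> card A = m \<and> card B = m \<and> card C = m \<and> (A \<times> B) \<times> C \<subseteq> R)"
    using complete_tripartite_exists[OF half_gt_zero[OF assms(1)], where 'a = 'a and m = m] by (elim exE)
  obtain n2 :: nat where n2: "6 * (real K + 3) / \<delta> \<le> n2" using real_arch_simple by blast
  show ?thesis
  proof (intro exI[of _ "max n1 n2"] allI impI, elim conjE)
    fix V :: "'a set" and E W c d e
    assume fin: "finite V" and n: "max n1 n2 \<le> card V" and E3: "\<forall>X\<in>E. card X = 3"
      and cde: "{c, d, e} \<in> E" "{c, d, e} \<subseteq> V - W" and W: "W \<subseteq> V" "card W \<le> K"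
      and big: "\<delta> * card V ^ 3 \<le>
        card {((a, b), x) \<in> (V \<times> V) \<times> V. {a, b, c} \<in> E \<and> {a, b, d} \<in> E \<and> {a, b, x} \<in> E}"
        (is "_ \<le> real (card ?R)")
    define N where "N = real (card V)"
    define W' where "W' = W \<union> {c, d, e}"
    define R' where "R' = {((a, b), x) \<in> ?R. a \<notin> W' \<and> b \<notin> W' \<and> x \<notin> W'}"
    have W': "W' \<subseteq> V" "finite W'" using W cde fin by (auto simp: W'_def intro: finite_subset)
    have "card W' \<le> card W + card {c, d, e}" unfolding W'_def by (rule card_Un_le)
    also have "card {c, d, e} \<le> 3" using card_insert_le_m1 by (simp add: card_insert_if)
    finally have cW': "card W' \<le> K + 3" using W by simp
    have "?R \<subseteq> R' \<union> ((W' \<times> V) \<times> V \<union> (V \<times> W') \<times> V \<union> (V \<times> V) \<times> W')" by (auto simp: R'_def)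
    then have "card ?R \<le> card (R' \<union> ((W' \<times> V) \<times> V \<union> (V \<times> W') \<times> V \<union> (V \<times> V) \<times> W'))"
      using fin W' by (intro card_mono) (auto simp: R'_def intro: finite_subset[of _ "(V \<times> V) \<times> V"])
    also have "\<dots> \<le> card R' + (card ((W' \<times> V) \<times> V) + card ((V \<times> W') \<times> V) + card ((V \<times> V) \<times> W'))"
      by (meson card_Un_le add_le_mono order_trans order_refl)
    also have "\<dots> = card R' + 3 * card W' * (card V)\<^sup>2"
      by (simp add: card_cartesian_product power2_eq_square)
    finally have "real (card ?R) \<le> real (card R' + 3 * card W' * (card V)\<^sup>2)" by (rule of_nat_mono)
    also have "\<dots> = card R' + 3 * real (card W') * N\<^sup>2" by (simp add: N_def)
    also have "\<dots> \<le> card R' + 3 * (real K + 3) * N\<^sup>2"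
      using cW' by (intro add_left_mono mult_right_mono) auto
    finally have "\<delta> * N ^ 3 - 3 * (real K + 3) * N\<^sup>2 \<le> card R'" using big by (simp add: N_def)
    moreover have "3 * (real K + 3) * N\<^sup>2 \<le> \<delta> / 2 * N * N\<^sup>2"
    proof (rule mult_right_mono)
      have "6 * (real K + 3) / \<delta> \<le> N" using n2 n by (simp add: N_def)
      then show "3 * (real K + 3) \<le> \<delta> / 2 * N" using assms by (simp add: field_simps)
    qed simp
    ultimately have "\<delta> / 2 * real (card V ^ 3) \<le> card R'"
      by (simp add: N_def power2_eq_square power3_eq_cube)
    moreover have "R' \<subseteq> (V \<times> V) \<times> V" by (auto simp: R'_def)
    ultimately obtain A B C where ABC: "A \<subseteq> V" "B \<subseteq> V" "C \<subseteq> V" "card A = m" "card B = m" "card C = m"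
      and R: "(A \<times> B) \<times> C \<subseteq> R'"
      using n1[rule_format, of V R'] fin n by auto
    have ne: "A \<noteq> {}" "B \<noteq> {}" "C \<noteq> {}" using ABC assms by auto
    have avoid: "A \<inter> W' = {}" "B \<inter> W' = {}" "C \<inter> W' = {}"
      using R ne unfolding R'_def by blast+
    have tri: "{a, b, x} \<in> E" "{a, b, c} \<in> E" "{a, b, d} \<in> E" if "a \<in> A" "b \<in> B" "x \<in> C" for a b x
      using R that unfolding R'_def by blast+
    have dist: "a \<noteq> b" "b \<noteq> x" "a \<noteq> x" if "a \<in> A" "b \<in> B" "x \<in> C" for a b x
      using tri(1)[OF that] E3 card_3_distinct by metis+
    have disj: "A \<inter> B = {}" "A \<inter> C = {}" "B \<inter> C = {}" using dist ne by blast+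
    have cd: "c \<noteq> d" "c \<noteq> e" "d \<noteq> e" using cde E3 card_3_distinct by metis+
    have "m - 2 \<le> card C" using ABC by simp
    then obtain C0 where C0: "C0 \<subseteq> C" "card C0 = m - 2"
      by (elim obtain_subset_with_card_n)
    define C1 where "C1 = insert c (insert d C0)"
    have finC0: "finite C0" using C0 ABC fin by (meson finite_subset)
    have "c \<notin> C0" "d \<notin> C0" using avoid C0 by (auto simp: W'_def)
    then have card1: "card C1 = m" using C0 cd finC0 assms by (simp add: C1_def)
    have "is_copy (F5S m) E (insert e (A \<union> B \<union> C1))"
    proof (rule F5S_copyI[OF assms(2) cde(1) cd(1)])
      show "{a, b, x} \<in> E" if "a \<in> A" "b \<in> B" "x \<in> C1" for a b x
      proof -
        obtain x' where "x' \<in> C" using ne by blast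
        then show ?thesis using that C0 tri(1)[of a b x] tri(2,3)[of a b x'] unfolding C1_def by blast
      qed
      show "c \<in> C1" "d \<in> C1" by (auto simp: C1_def)
      show "A \<inter> C1 = {}" "B \<inter> C1 = {}" "e \<notin> A \<union> B \<union> C1"
        using disj avoid C0 cd by (auto simp: C1_def W'_def)
    qed (use ABC disj card1 in auto)
    moreover have "insert e (A \<union> B \<union> C1) \<subseteq> V - W"
      using ABC C0 avoid cde by (auto simp: C1_def W'_def)
    ultimately show "\<exists>U\<subseteq>V - W. is_copy (F5S m) E U" by blast
  qed
qed

section \<open>Links that rarely overlap\<close>

lemma sum_swap3:
  "(\<Sum>x\<in>A. \<Sum>y\<in>B. \<Sum>z\<in>C. f x y z) = (\<Sum>z\<in>C. \<Sum>x\<in>A. \<Sum>y\<in>B. f x y z)"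
  for f :: "_ \<Rightarrow> _ \<Rightarrow> _ \<Rightarrow> 'b::comm_monoid_add"
proof -
  have "(\<Sum>x\<in>A. \<Sum>y\<in>B. \<Sum>z\<in>C. f x y z) = (\<Sum>x\<in>A. \<Sum>z\<in>C. \<Sum>y\<in>B. f x y z)"
    by (intro sum.cong refl sum.swap)
  also have "\<dots> = (\<Sum>z\<in>C. \<Sum>x\<in>A. \<Sum>y\<in>B. f x y z)" by (rule sum.swap)
  finally show ?thesis .
qed

text \<open>
  Equality holds at the extremal values \<open>d = 2 n\<^sup>2 / 9\<close>, \<open>D = 2 n / 3\<close>,
  \<open>s = 2 n\<^sup>3 / 27\<close>: this is the tangent of the degree bound at that point.
\<close>

lemma degree_tradeoff:
  fixes d D s n :: real
  assumes "0 \<le> d" "0 \<le> D" "0 \<le> s" "D \<le> n" "d\<^sup>2 \<le> D * s"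
  shows "d * n - 2 * n ^ 3 / 27 \<le> s + d * D / 2"
proof (cases "D = 0")
  case True
  then have "d = 0" using assms by simp
  have "0 \<le> n ^ 3" using assms by simp
  then have "- (2 * n ^ 3 / 27) \<le> s" using assms(3) by linarith
  then show ?thesis using True \<open>d = 0\<close> by simp
next
  case False
  then have D: "0 < D" using assms by simp
  \<comment> \<open>After multiplication by \<open>D\<close> the claim reads d b <= D s + (2/27) n^3
    D. The estimate d b <= d^2 + b^2 / 4 used below is tight at d = b / 2, which holds at the
    tripartite values.\<close>
  define b where "b = n * D - D\<^sup>2 / 2"
  \<comment> \<open>On the interval from 0 to n the left side peaks at D = 2 n / 3 with value 8 n^3;
    hence the double root there in the factorisation.\<close>
  have "27 * D * (n - D / 2)\<^sup>2 \<le> 8 * n ^ 3"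
  proof -
    have "0 \<le> 27 / 4 * (D - 2 * n / 3)\<^sup>2 * (8 / 3 * n - D)"
      using assms by (intro mult_nonneg_nonneg) auto
    also have "\<dots> = 8 * n ^ 3 - 27 * D * (n - D / 2)\<^sup>2"
      by (simp add: power2_eq_square power3_eq_cube field_simps)
    finally show ?thesis by simp
  qed
  then have disc: "b\<^sup>2 \<le> 8 / 27 * n ^ 3 * D"
    using D mult_left_mono[of "27 * D * (n - D / 2)\<^sup>2" "8 * n ^ 3" "D / 27"]
    by (simp add: b_def power2_eq_square field_simps)
  have "0 \<le> (d - b / 2)\<^sup>2" by simp
  then have "d * b \<le> d\<^sup>2 + b\<^sup>2 / 4" by (simp add: power2_eq_square field_simps)
  also have "\<dots> \<le> D * s + 2 / 27 * n ^ 3 * D" using disc assms by simp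
  finally have "D * (d * n - d * D / 2) \<le> D * (s + 2 / 27 * n ^ 3)"
    by (simp add: b_def power2_eq_square field_simps)
  then show ?thesis using D by simp
qed

text \<open>Edges form a symmetric ternary relation because the argument will run on a pruned
  subgraph. The assumption \<open>sparse\<close> is all that is retained of having no copy.\<close>

locale sparse_links =
  fixes V :: "'a set" and E :: "'a \<Rightarrow> 'a \<Rightarrow> 'a \<Rightarrow> bool" and g n :: real
  assumes fin: "finite V" and n_def: "n = card V" and n_pos: "0 < n"
    and sym12: "E x y z \<Longrightarrow> E y x z" and sym23: "E x y z \<Longrightarrow> E x z y"
    and g_pos: "0 < g" and g_le: "g \<le> 1 / 9"
    and sparse: "\<lbrakk>x \<in> V; y \<in> V; z \<in> V; E x y z\<rbrakk> \<Longrightarrow>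
      (\<Sum>u\<in>V. \<Sum>v\<in>V. of_bool (E u v x \<and> E u v y)) \<le> g * n\<^sup>2"
begin

lemma sym_simps: "E y x z \<longleftrightarrow> E x y z" "E x z y \<longleftrightarrow> E x y z" "E z x y \<longleftrightarrow> E x y z"
    "E y z x \<longleftrightarrow> E x y z" "E z y x \<longleftrightarrow> E x y z"
  using sym12 sym23 by blast+

text \<open>All counts are over ordered pairs and triples, so \<open>total\<close> is six times the number of edges.\<close>

definition shadow :: "'a \<Rightarrow> 'a \<Rightarrow> bool" where
  "shadow x y \<longleftrightarrow> (\<exists>z\<in>V. E x y z)"

definition codeg :: "'a \<Rightarrow> 'a \<Rightarrow> real" where
  "codeg x y = (\<Sum>z\<in>V. of_bool (E x y z))"

definition deg :: "'a \<Rightarrow> real" where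
  "deg z = (\<Sum>x\<in>V. \<Sum>y\<in>V. of_bool (E x y z))"

definition sdeg :: "'a \<Rightarrow> real" where
  "sdeg z = (\<Sum>w\<in>V. of_bool (shadow z w))"

definition total :: real where
  "total = (\<Sum>x\<in>V. \<Sum>y\<in>V. \<Sum>z\<in>V. of_bool (E x y z))"

definition codeg_sq :: real where
  "codeg_sq = (\<Sum>x\<in>V. \<Sum>y\<in>V. (codeg x y)\<^sup>2)"

text \<open>The error term of the whole count: it vanishes for a complete tripartite graph, where
  each codegree neighbourhood lies inside one class.\<close>

definition spoilt :: "'a \<Rightarrow> 'a \<Rightarrow> real" where
  "spoilt x y = (\<Sum>z\<in>V. \<Sum>w\<in>V. of_bool (E x y z \<and> E x y w \<and> shadow z w))"

text \<open>After exchanging the sums, the pairs counted for a fixed adjacent pair \<open>z\<close>,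
  \<open>w\<close> form its common link, which \<open>sparse\<close> bounds.\<close>

lemma spoilt_sum: "(\<Sum>x\<in>V. \<Sum>y\<in>V. spoilt x y) \<le> g * n ^ 4"
proof -
  have "(\<Sum>x\<in>V. \<Sum>y\<in>V. spoilt x y) =
      (\<Sum>z\<in>V. \<Sum>w\<in>V. \<Sum>x\<in>V. \<Sum>y\<in>V. of_bool (E x y z \<and> E x y w \<and> shadow z w))"
    unfolding spoilt_def
    by (rule trans[OF sum_swap3]) (intro sum.cong refl sum_swap3)
  also have "\<dots> \<le> (\<Sum>z\<in>V. \<Sum>w\<in>V. g * n\<^sup>2)"
  proof (intro sum_mono)
    fix z w assume zw: "z \<in> V" "w \<in> V"
    show "(\<Sum>x\<in>V. \<Sum>y\<in>V. of_bool (E x y z \<and> E x y w \<and> shadow z w)) \<le> g * n\<^sup>2"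
    proof (cases "shadow z w")
      case True
      then obtain v where "v \<in> V" "E z w v" by (auto simp: shadow_def)
      then show ?thesis using sparse[of z w v] zw True by simp
    next
      case False
      then show ?thesis using g_pos by simp
    qed
  qed
  also have "\<dots> = g * n ^ 4" by (simp add: n_def[symmetric] power2_eq_square eval_nat_numeral)
  finally show ?thesis .
qed

text \<open>Take an ordered edge xyz and a fourth vertex w. Being adjacent to z and completing xy to
  an edge can both happen only for a pair z, w counted by \<open>spoilt\<close>; otherwise w is
  counted at most once.\<close>

lemma sdeg_codeg: "(\<Sum>z\<in>V. deg z * sdeg z) + codeg_sq \<le> n * total + g * n ^ 4"
proof -
  have 1: "(\<Sum>x\<in>V. \<Sum>y\<in>V. \<Sum>z\<in>V. \<Sum>w\<in>V. of_bool (E x y z) * of_bool (shadow z w)) =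
      (\<Sum>z\<in>V. deg z * sdeg z)"
    unfolding deg_def sdeg_def
    by (rule trans[OF sum_swap3]) (simp flip: sum_distrib_left sum_distrib_right)
  have 2: "(\<Sum>x\<in>V. \<Sum>y\<in>V. \<Sum>z\<in>V. \<Sum>w\<in>V. of_bool (E x y z) * of_bool (E x y w)) = codeg_sq"
    unfolding codeg_sq_def codeg_def power2_eq_square
    by (simp add: sum_distrib_left sum_distrib_right mult.commute)
  have 3: "(\<Sum>x\<in>V. \<Sum>y\<in>V. \<Sum>z\<in>V. \<Sum>w\<in>V. of_bool (E x y z)) = n * total"
    unfolding total_def by (simp add: n_def sum_distrib_left)
  have "(\<Sum>x\<in>V. \<Sum>y\<in>V. \<Sum>z\<in>V. \<Sum>w\<in>V.
      of_bool (E x y z) * of_bool (shadow z w) + of_bool (E x y z) * of_bool (E x y w)) \<le>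
    (\<Sum>x\<in>V. \<Sum>y\<in>V. \<Sum>z\<in>V. \<Sum>w\<in>V.
      of_bool (E x y z) + (of_bool (E x y z \<and> E x y w \<and> shadow z w) :: real))"
    by (intro sum_mono) auto
  then show ?thesis
    using spoilt_sum unfolding spoilt_def by (simp only: sum.distrib 1 2 3)
qed

text \<open>\<open>degree_tradeoff\<close> summed over all vertices leaves half of the sum of
  \<open>deg z * sdeg z\<close>. Replacing it through \<open>sdeg_codeg\<close> absorbs half of
  \<open>codeg_sq\<close>, and clearing that factor turns 2/27 into 4/27.\<close>

lemma codeg_sq_lower: "n * total - 4 / 27 * n ^ 4 - g * n ^ 4 \<le> codeg_sq"
proof -
  have "deg z * n - 2 * n ^ 3 / 27 \<le> (\<Sum>x\<in>V. (codeg x z)\<^sup>2) + deg z * sdeg z / 2"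
    if z: "z \<in> V" for z
  proof (rule degree_tradeoff)
    show "0 \<le> deg z" "0 \<le> sdeg z" "0 \<le> (\<Sum>x\<in>V. (codeg x z)\<^sup>2)"
      by (auto simp: deg_def sdeg_def intro!: sum_nonneg)
    show "sdeg z \<le> n"
      unfolding sdeg_def n_def using fin by (simp add: sum.If_cases of_bool_def card_mono)
    have codeg_eq: "codeg x z = of_bool (shadow z x) * codeg x z" for x
    proof (cases "shadow z x")
      case False
      then have "\<forall>y\<in>V. \<not> E x z y" using sym12 by (auto simp: shadow_def)
      then show ?thesis by (simp add: codeg_def)
    qed simp
    have "deg z = (\<Sum>x\<in>V. codeg x z)"
      by (simp add: deg_def codeg_def sym_simps)
    also have "\<dots> = (\<Sum>x\<in>V. of_bool (shadow z x) * codeg x z)"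
      by (rule sum.cong[OF refl codeg_eq])
    finally have "(deg z)\<^sup>2 = (\<Sum>x\<in>V. of_bool (shadow z x) * codeg x z)\<^sup>2" by simp
    also have "\<dots> \<le> (\<Sum>x\<in>V. (of_bool (shadow z x))\<^sup>2) * (\<Sum>x\<in>V. (codeg x z)\<^sup>2)"
      by (rule Cauchy_Schwarz_ineq_sum)
    also have "(\<Sum>x\<in>V. (of_bool (shadow z x))\<^sup>2) = sdeg z"
      by (auto simp: sdeg_def intro!: sum.cong)
    finally show "(deg z)\<^sup>2 \<le> sdeg z * (\<Sum>x\<in>V. (codeg x z)\<^sup>2)" .
  qed
  then have "(\<Sum>z\<in>V. deg z * n - 2 * n ^ 3 / 27) \<le>
      (\<Sum>z\<in>V. (\<Sum>x\<in>V. (codeg x z)\<^sup>2) + deg z * sdeg z / 2)"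
    by (rule sum_mono)
  moreover have "(\<Sum>z\<in>V. \<Sum>x\<in>V. (codeg x z)\<^sup>2) = codeg_sq"
    unfolding codeg_sq_def by (rule sum.swap)
  moreover have "(\<Sum>z\<in>V. deg z) = total"
    unfolding deg_def total_def by (subst (2) sum_swap3) simp
  ultimately have "n * total - 2 / 27 * n ^ 4 \<le> codeg_sq + (\<Sum>z\<in>V. deg z * sdeg z) / 2"
    by (simp add: sum.distrib sum_subtractf n_def[symmetric] sum_divide_distrib
        eval_nat_numeral flip: sum_distrib_right) (simp add: field_simps)
  then show ?thesis using sdeg_codeg by (simp add: field_simps)
qed

text \<open>
  Summed over the three rotations of an edge, the first two terms bound from below the size of
  the union of its three codegree neighbourhoods (inclusion-exclusion); the last term is the
  cost of adjacent pairs inside one of them.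
\<close>

definition gain :: "'a \<Rightarrow> 'a \<Rightarrow> 'a \<Rightarrow> real" where
  "gain u v w = codeg u v - (\<Sum>s\<in>V. of_bool (E u v s \<and> E u w s)) - spoilt u v / n"

text \<open>If s lies in N(uv) and N(uw) for an edge uvw, then v and w are adjacent and both lie in
  N(us), so overlaps are again bounded by \<open>spoilt_sum\<close>. In the last term the division
  by \<open>n\<close> cancels the sum over w. Each correction costs g n^4.\<close>

lemma gain_sum: "codeg_sq - 2 * g * n ^ 4 \<le> (\<Sum>u\<in>V. \<Sum>v\<in>V. \<Sum>w\<in>V. of_bool (E u v w) * gain u v w)"
proof -
  have 1: "(\<Sum>u\<in>V. \<Sum>v\<in>V. \<Sum>w\<in>V. of_bool (E u v w) * codeg u v) = codeg_sq"
    unfolding codeg_sq_def power2_eq_square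
    by (simp add: codeg_def sum_distrib_right)
  have "(\<Sum>u\<in>V. \<Sum>v\<in>V. \<Sum>w\<in>V. of_bool (E u v w) * (\<Sum>s\<in>V. of_bool (E u v s \<and> E u w s)))
      \<le> (\<Sum>u\<in>V. \<Sum>v\<in>V. \<Sum>w\<in>V. \<Sum>s\<in>V. (of_bool (E u s v \<and> E u s w \<and> shadow v w) :: real))"
    unfolding sum_distrib_left
  proof (intro sum_mono)
    fix u v w s assume "u \<in> V"
    have "E u s v \<and> E u s w \<and> shadow v w" if "E u v w" "E u v s" "E u w s"
      using that sym12[of u v w] sym23 sym12 \<open>u \<in> V\<close> unfolding shadow_def by metis
    then show "of_bool (E u v w) * of_bool (E u v s \<and> E u w s) \<le>
        (of_bool (E u s v \<and> E u s w \<and> shadow v w) :: real)"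
      by simp
  qed
  also have "\<dots> = (\<Sum>u\<in>V. \<Sum>s\<in>V. spoilt u s)"
    unfolding spoilt_def by (rule sum.cong[OF refl sum_swap3])
  also have "\<dots> \<le> g * n ^ 4" by (rule spoilt_sum)
  finally have 2: "(\<Sum>u\<in>V. \<Sum>v\<in>V. \<Sum>w\<in>V. of_bool (E u v w) * (\<Sum>s\<in>V. of_bool (E u v s \<and> E u w s))) \<le> g * n ^ 4" .
  have sp: "0 \<le> spoilt u v" for u v by (auto simp: spoilt_def intro!: sum_nonneg)
  have "(\<Sum>u\<in>V. \<Sum>v\<in>V. \<Sum>w\<in>V. of_bool (E u v w) * (spoilt u v / n)) \<le>
      (\<Sum>u\<in>V. \<Sum>v\<in>V. \<Sum>w\<in>V. spoilt u v / n)"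
    using sp n_pos by (intro sum_mono) auto
  also have "\<dots> = (\<Sum>u\<in>V. \<Sum>v\<in>V. spoilt u v)" using n_pos by (simp add: n_def[symmetric])
  also have "\<dots> \<le> g * n ^ 4" by (rule spoilt_sum)
  finally show ?thesis
    using 1 2 unfolding gain_def by (simp add: right_diff_distrib sum_subtractf)
qed

lemma good_triple:
  assumes tot: "(2 / 9 - g) * n ^ 3 \<le> total"
  obtains u v w where "u \<in> V" "v \<in> V" "w \<in> V" "E u v w"
    "(1 - 100 * g) * n \<le> gain u v w + gain v w u + gain w u v"
proof -
  define c where "c = (1 - 100 * g) * n"
  have rot: "(\<Sum>u\<in>V. \<Sum>v\<in>V. \<Sum>w\<in>V. of_bool (E u v w) * h v w u) =
      (\<Sum>u\<in>V. \<Sum>v\<in>V. \<Sum>w\<in>V. of_bool (E u v w) * h u v w)" for h :: "'a \<Rightarrow> 'a \<Rightarrow> 'a \<Rightarrow> real"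
    by (subst (2) sum_swap3) (simp add: sym_simps)
  have "\<exists>u\<in>V. \<exists>v\<in>V. \<exists>w\<in>V. E u v w \<and> c \<le> gain u v w + gain v w u + gain w u v"
  proof (rule ccontr)
    assume "\<not> ?thesis"
    then have "(\<Sum>u\<in>V. \<Sum>v\<in>V. \<Sum>w\<in>V. of_bool (E u v w) *
        (gain u v w + gain v w u + gain w u v - c)) \<le> 0"
      by (intro sum_nonpos) (auto simp: not_le of_bool_def intro: less_imp_le)
    moreover have "(\<Sum>u\<in>V. \<Sum>v\<in>V. \<Sum>w\<in>V. of_bool (E u v w) *
        (gain u v w + gain v w u + gain w u v - c)) =
      3 * (\<Sum>u\<in>V. \<Sum>v\<in>V. \<Sum>w\<in>V. of_bool (E u v w) * gain u v w) - c * total"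
    proof -
      have "(\<Sum>u\<in>V. \<Sum>v\<in>V. \<Sum>w\<in>V. of_bool (E u v w) * gain v w u) =
          (\<Sum>u\<in>V. \<Sum>v\<in>V. \<Sum>w\<in>V. of_bool (E u v w) * gain u v w)"
        by (rule rot)
      moreover have "(\<Sum>u\<in>V. \<Sum>v\<in>V. \<Sum>w\<in>V. of_bool (E u v w) * gain w u v) =
          (\<Sum>u\<in>V. \<Sum>v\<in>V. \<Sum>w\<in>V. of_bool (E u v w) * gain u v w)"
        using rot[of "\<lambda>u v w. gain v w u"] rot[of gain] by simp
      moreover have "(\<Sum>u\<in>V. \<Sum>v\<in>V. \<Sum>w\<in>V. of_bool (E u v w) * c) = c * total"
        by (simp add: total_def sum_distrib_left mult.commute)
      ultimately show ?thesis
        by (simp add: distrib_left right_diff_distrib sum.distrib sum_subtractf)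
    qed
    ultimately have "3 * codeg_sq - 6 * g * n ^ 4 \<le> c * total" using gain_sum by simp
    then have "3 * (n * total) - 12 / 27 * n ^ 4 - 9 * g * n ^ 4 \<le> c * total"
      using codeg_sq_lower by simp
    then have *: "(2 * n + 100 * g * n) * total \<le> 12 / 27 * n ^ 4 + 9 * g * n ^ 4"
      by (simp add: c_def algebra_simps)
    have "2 * n * ((2 / 9 - g) * n ^ 3) \<le> 2 * n * total"
      using tot n_pos by (intro mult_left_mono) auto
    moreover have "(1 / 9) * n ^ 3 \<le> total"
    proof -
      have "(1 / 9) * n ^ 3 \<le> (2 / 9 - g) * n ^ 3" using g_le n_pos by (intro mult_right_mono) auto
      then show ?thesis using tot by linarith
    qed
    then have "100 * g * n * ((1 / 9) * n ^ 3) \<le> 100 * g * n * total"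
      using n_pos g_pos by (intro mult_left_mono) auto
    \<comment> \<open>This fixes the constant 100: as \<open>g \<le> 1 / 9\<close> gives
      \<open>total\<close> at least n^3 / 9, the contradiction needs 100/9 - 2 > 9.\<close>
    ultimately have "4 / 9 * n ^ 4 - 2 * g * n ^ 4 + 100 / 9 * (g * n ^ 4) \<le> 12 / 27 * n ^ 4 + 9 * g * n ^ 4"
      using * by (simp add: algebra_simps eval_nat_numeral)
    moreover have "0 < g * n ^ 4" using g_pos n_pos by simp
    ultimately show False by (simp add: algebra_simps)
  qed
  then show ?thesis using that unfolding c_def by blast
qed

text \<open>The classes are the codegree neighbourhoods of a good edge, the last one also taking all
  uncovered vertices. A non-transversal edge then contains an uncovered vertex
  (\<open>\<rho>\<close>) or an adjacent pair inside one neighbourhood (\<open>b\<close>). Three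
  positions with loss 100 g n each, plus the deficit g of the hypothesis, give 301.\<close>

lemma tripartition:
  assumes tot: "(2 / 9 - g) * n ^ 3 \<le> total"
  shows "\<exists>c :: 'a \<Rightarrow> nat. (\<forall>x. c x < 3) \<and> (2 / 9 - 301 * g) * n ^ 3 \<le>
    (\<Sum>x\<in>V. \<Sum>y\<in>V. \<Sum>z\<in>V. of_bool (E x y z \<and> c x \<noteq> c y \<and> c y \<noteq> c z \<and> c x \<noteq> c z))"
proof -
  obtain u v w where uvw: "u \<in> V" "v \<in> V" "w \<in> V" "E u v w"
    and gain: "(1 - 100 * g) * n \<le> gain u v w + gain v w u + gain w u v"
    using good_triple[OF tot] by blast
  define c :: "'a \<Rightarrow> nat" where "c x = (if E u v x then 0 else if E v w x then 1 else 2)" for x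
  define \<rho> :: "'a \<Rightarrow> real" where "\<rho> x = of_bool (\<not> E u v x \<and> \<not> E v w x \<and> \<not> E w u x)" for x
  define b :: "'a \<Rightarrow> 'a \<Rightarrow> real" where "b x y = of_bool (E u v x \<and> E u v y \<and> shadow x y) +
    of_bool (E v w x \<and> E v w y \<and> shadow x y) + of_bool (E w u x \<and> E w u y \<and> shadow x y)" for x y
  define loss where "loss = (\<Sum>x\<in>V. \<rho> x) + (\<Sum>x\<in>V. \<Sum>y\<in>V. b x y) / n"
  \<comment> \<open>Bonferroni for the three neighbourhoods: the union is at least the sum of the
    sizes minus the pairwise overlaps. Each overlap is charged to one \<open>gain\<close>.\<close>
  have "(\<Sum>x\<in>V. \<rho> x) \<le> (\<Sum>x\<in>V. 1 - of_bool (E u v x) - of_bool (E v w x) - of_bool (E w u x) +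
      of_bool (E u v x \<and> E u w x) + of_bool (E v w x \<and> E v u x) + of_bool (E w u x \<and> E w v x))"
  proof (intro sum_mono)
    fix x
    have "E u w x \<longleftrightarrow> E w u x" "E v u x \<longleftrightarrow> E u v x" "E w v x \<longleftrightarrow> E v w x"
      using sym12 by blast+
    then show "\<rho> x \<le> 1 - of_bool (E u v x) - of_bool (E v w x) - of_bool (E w u x) +
      of_bool (E u v x \<and> E u w x) + of_bool (E v w x \<and> E v u x) + of_bool (E w u x \<and> E w v x)"
      by (simp add: \<rho>_def of_bool_def)
  qed
  moreover have "(\<Sum>x\<in>V. \<Sum>y\<in>V. b x y) = spoilt u v + spoilt v w + spoilt w u"
    by (simp add: b_def spoilt_def sum.distrib)
  ultimately have "loss \<le> n - (gain u v w + gain v w u + gain w u v)"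
    by (simp add: loss_def gain_def codeg_def sum.distrib sum_subtractf n_def[symmetric] add_divide_distrib)
  then have loss: "loss \<le> 100 * g * n" using gain by (simp add: algebra_simps)
  have "total \<le> (\<Sum>x\<in>V. \<Sum>y\<in>V. \<Sum>z\<in>V.
      of_bool (E x y z \<and> c x \<noteq> c y \<and> c y \<noteq> c z \<and> c x \<noteq> c z) +
      (\<rho> x + \<rho> y + \<rho> z + b x y + b y z + b x z))"
    unfolding total_def
  proof (intro sum_mono)
    fix x y z assume V: "x \<in> V" "y \<in> V" "z \<in> V"
    have nn: "0 \<le> \<rho> x" "0 \<le> \<rho> y" "0 \<le> \<rho> z" "0 \<le> b x y" "0 \<le> b y z" "0 \<le> b x z"
      by (auto simp: \<rho>_def b_def)
    have pair: "1 \<le> \<rho> p + \<rho> q + b p q" if "shadow p q" "c p = c q" for p q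
      using that by (auto simp: \<rho>_def b_def c_def split: if_splits)
    have "1 \<le> \<rho> x + \<rho> y + \<rho> z + b x y + b y z + b x z"
      if "E x y z" "c x = c y \<or> c y = c z \<or> c x = c z"
    proof -
      have "shadow x y" "shadow y z" "shadow x z"
        using that(1) V sym12 sym23 unfolding shadow_def by blast+
      then show ?thesis using pair[of x y] pair[of y z] pair[of x z] that(2) nn by auto
    qed
    then show "of_bool (E x y z) \<le> of_bool (E x y z \<and> c x \<noteq> c y \<and> c y \<noteq> c z \<and> c x \<noteq> c z) +
      (\<rho> x + \<rho> y + \<rho> z + b x y + b y z + b x z)"
      using nn by (auto simp: of_bool_def)
  qed
  also have "\<dots> = (\<Sum>x\<in>V. \<Sum>y\<in>V. \<Sum>z\<in>V.
      of_bool (E x y z \<and> c x \<noteq> c y \<and> c y \<noteq> c z \<and> c x \<noteq> c z)) + 3 * n\<^sup>2 * loss"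
  proof -
    have "(\<Sum>x\<in>V. \<Sum>y\<in>V. \<Sum>z\<in>V. \<rho> x + \<rho> y + \<rho> z + b x y + b y z + b x z) = 3 * n\<^sup>2 * loss"
    proof -
      define r where "r = (\<Sum>x\<in>V. \<rho> x)"
      define \<beta> where "\<beta> = (\<Sum>x\<in>V. \<Sum>y\<in>V. b x y)"
      have "(\<Sum>x\<in>V. \<Sum>y\<in>V. \<Sum>z\<in>V. \<rho> x) = n * n * r"
        "(\<Sum>x\<in>V. \<Sum>y\<in>V. \<Sum>z\<in>V. \<rho> y) = n * n * r"
        "(\<Sum>x\<in>V. \<Sum>y\<in>V. \<Sum>z\<in>V. \<rho> z) = n * n * r"
        by (simp_all add: r_def n_def sum_distrib_left mult.assoc)
      note \<rho>s = this
      have "(\<Sum>x\<in>V. \<Sum>y\<in>V. \<Sum>z\<in>V. b x y) = n * \<beta>"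
        "(\<Sum>x\<in>V. \<Sum>y\<in>V. \<Sum>z\<in>V. b y z) = n * \<beta>"
        "(\<Sum>x\<in>V. \<Sum>y\<in>V. \<Sum>z\<in>V. b x z) = n * \<beta>"
        by (simp_all add: \<beta>_def n_def sum_distrib_left)
      note bs = this
      have "3 * n\<^sup>2 * loss = n * n * r + n * n * r + n * n * r + n * \<beta> + n * \<beta> + n * \<beta>"
        using n_pos by (simp add: loss_def r_def \<beta>_def power2_eq_square field_simps)
      then show ?thesis by (simp only: sum.distrib \<rho>s bs)
    qed
    then show ?thesis by (simp only: sum.distrib)
  qed
  also have "\<dots> \<le> (\<Sum>x\<in>V. \<Sum>y\<in>V. \<Sum>z\<in>V.
      of_bool (E x y z \<and> c x \<noteq> c y \<and> c y \<noteq> c z \<and> c x \<noteq> c z)) + 3 * n\<^sup>2 * (100 * g * n)"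
    using loss by (intro add_left_mono mult_left_mono) auto
  finally have "(2 / 9 - 301 * g) * n ^ 3 \<le>
    (\<Sum>x\<in>V. \<Sum>y\<in>V. \<Sum>z\<in>V. of_bool (E x y z \<and> c x \<noteq> c y \<and> c y \<noteq> c z \<and> c x \<noteq> c z))"
    using tot by (simp add: algebra_simps power2_eq_square power3_eq_cube)
  moreover have "\<forall>x. c x < 3" by (simp add: c_def)
  ultimately show ?thesis by blast
qed

end

section \<open>Stability\<close>

lemma card_orderings:
  assumes "card e = 3" "e \<subseteq> V"
  shows "card {(x, y, z) \<in> V \<times> V \<times> V. {x, y, z} = e} = 6"
proof -
  obtain a b c where e: "e = {a, b, c}" and d: "a \<noteq> b" "b \<noteq> c" "a \<noteq> c"
    using assms(1) by (auto simp: card_3_iff)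
  have "{(x, y, z) \<in> V \<times> V \<times> V. {x, y, z} = e} =
      {(a, b, c), (a, c, b), (b, a, c), (b, c, a), (c, a, b), (c, b, a)}" (is "?L = ?R")
  proof
    show "?R \<subseteq> ?L" using assms(2) by (auto simp: e)
    show "?L \<subseteq> ?R"
    proof
      fix p assume "p \<in> ?L"
      then obtain x y z where p: "p = (x, y, z)" and eq: "{x, y, z} = {a, b, c}" by (auto simp: e)
      then have "card {x, y, z} = 3" using d by simp
      then have "x \<noteq> y" "y \<noteq> z" "x \<noteq> z" using card_3_distinct by metis+
      moreover have "x \<in> {a, b, c}" "y \<in> {a, b, c}" "z \<in> {a, b, c}" using eq by blast+
      ultimately show "p \<in> ?R" using p by auto
    qed
  qed
  then show ?thesis using d by simp
qed

lemma sum_ordered_triples: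
  assumes fin: "finite V" and E: "\<And>e. e \<in> E \<Longrightarrow> e \<subseteq> V \<and> card e = 3"
  shows "(\<Sum>x\<in>V. \<Sum>y\<in>V. \<Sum>z\<in>V. of_bool ({x, y, z} \<in> E)) = (6 * real (card E))"
proof -
  have finE: "finite E" using finite_subset[of E "Pow V"] E fin by auto
  have "(\<Sum>x\<in>V. \<Sum>y\<in>V. \<Sum>z\<in>V. of_bool ({x, y, z} \<in> E)) =
      (\<Sum>p\<in>V \<times> V \<times> V. (of_bool (case p of (x, y, z) \<Rightarrow> {x, y, z} \<in> E) :: real))"
    by (simp add: sum.cartesian_product case_prod_unfold)
  also have "\<dots> = (\<Sum>p\<in>V \<times> V \<times> V. \<Sum>e\<in>E. of_bool (case p of (x, y, z) \<Rightarrow> {x, y, z} = e))"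
    using finE by (intro sum.cong refl) (auto simp: sum_of_bool_eq split: prod.splits)
  also have "\<dots> = (\<Sum>e\<in>E. \<Sum>p\<in>V \<times> V \<times> V. of_bool (case p of (x, y, z) \<Rightarrow> {x, y, z} = e))"
    by (rule sum.swap)
  also have "\<dots> = (\<Sum>e\<in>E. 6)"
  proof (rule sum.cong[OF refl])
    fix e assume "e \<in> E"
    have "(\<Sum>p\<in>V \<times> V \<times> V. (of_bool (case p of (x, y, z) \<Rightarrow> {x, y, z} = e) :: real)) =
        card {(x, y, z) \<in> V \<times> V \<times> V. {x, y, z} = e}"
      using fin by (subst sum_of_bool_eq) (auto intro!: arg_cong[where f = card])
    then show "(\<Sum>p\<in>V \<times> V \<times> V. (of_bool (case p of (x, y, z) \<Rightarrow> {x, y, z} = e) :: real)) = 6"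
      using card_orderings[of e V] E[OF \<open>e \<in> E\<close>] by simp
  qed
  finally show ?thesis by simp
qed

lemma sum_pairs_of_bool:
  assumes "finite V"
  shows "(\<Sum>u\<in>V. \<Sum>v\<in>V. of_bool (P u v)) = real (card {(u, v) \<in> V \<times> V. P u v})"
proof -
  have "(\<Sum>u\<in>V. \<Sum>v\<in>V. of_bool (P u v)) = (\<Sum>p\<in>V \<times> V. (of_bool (P (fst p) (snd p)) :: real))"
    by (simp add: sum.cartesian_product case_prod_unfold del: sum_of_bool_eq)
  also have "\<dots> = real (card {(u, v) \<in> V \<times> V. P u v})"
    using assms by (subst sum_of_bool_eq) (auto intro!: arg_cong[where f = card])
  finally show ?thesis .
qed

text \<open>\<open>U\<close> will be the vertex set of a maximal packing, so that no copy survives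
  outside it; its bounded size makes it negligible.\<close>

lemma stability:
  fixes \<eta> :: real and K m :: nat
  assumes "0 < \<eta>" "2 \<le> m"
  shows "\<exists>\<theta>>0. \<exists>n0. \<forall>V :: 'a set. \<forall>E U. finite V \<and> n0 \<le> card V \<and> (\<forall>X\<in>E. X \<subseteq> V \<and> card X = 3) \<and>
    U \<subseteq> V \<and> card U \<le> K \<and> \<not> (\<exists>P\<subseteq>V - U. is_copy (F5S m) E P) \<and>
    (1 / 27 - \<theta>) * card V ^ 3 \<le> card E \<longrightarrow>
    (\<exists>c :: 'a \<Rightarrow> nat. (\<forall>x. c x < 3) \<and> (1 / 27 - \<eta>) * card V ^ 3 \<le> card {e \<in> E. inj_on c e})"
proof -
  \<comment> \<open>The bound \<open>\<eta> / 60\<close> makes 301 g at most 6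
    \<open>\<eta>\<close>. The choices of \<open>\<beta>\<close> and \<open>\<theta>\<close> split
    the budget g: 3 \<open>\<beta>\<close> = g/4 for light pairs, 6 \<open>\<theta>\<close> = g/4
    for the density deficit, and g/2 for the edges meeting \<open>U\<close>.\<close>
  define g where "g = min (1 / 9) (\<eta> / 60)"
  have g: "0 < g" "g \<le> 1 / 9" "g \<le> \<eta> / 60" using assms by (auto simp: g_def)
  define \<beta> where "\<beta> = g / 12"
  define \<theta> where "\<theta> = g / 24"
  have \<beta>: "0 < \<beta>" and \<theta>: "0 < \<theta>" using g by (auto simp: \<beta>_def \<theta>_def)
  have gb: "0 < g * \<beta>" using g \<beta> by simp
  obtain n1 where n1: "\<forall>V :: 'a set. \<forall>E W c d e. finite V \<and> n1 \<le> card V \<and> (\<forall>X\<in>E. card X = 3) \<and>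
    {c, d, e} \<in> E \<and> {c, d, e} \<subseteq> V - W \<and> W \<subseteq> V \<and> card W \<le> K \<and>
    g * \<beta> * card V ^ 3 \<le> card {((a, b), x) \<in> (V \<times> V) \<times> V. {a, b, c} \<in> E \<and> {a, b, d} \<in> E \<and> {a, b, x} \<in> E} \<longrightarrow>
    (\<exists>U\<subseteq>V - W. is_copy (F5S m) E U)"
    using copy_from_common_links[OF gb assms(2), where 'a = 'a and K = K] by (elim exE)
  obtain n2 :: nat where n2: "6 * real K / g \<le> n2" using real_arch_simple by blast
  show ?thesis
  proof (intro exI[of _ \<theta>] conjI \<theta> exI[of _ "max 1 (max n1 n2)"] allI impI, elim conjE)
    fix V :: "'a set" and E U
    assume fin: "finite V" and n: "max 1 (max n1 n2) \<le> card V" and E: "\<forall>X\<in>E. X \<subseteq> V \<and> card X = 3"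
      and U: "U \<subseteq> V" "card U \<le> K" and free: "\<not> (\<exists>P\<subseteq>V - U. is_copy (F5S m) E P)"
      and big: "(1 / 27 - \<theta>) * card V ^ 3 \<le> card E"
    define N where "N = real (card V)"
    have N: "0 < N" using n by (simp add: N_def)
    \<comment> \<open>A large common link produces many triples for
      \<open>copy_from_common_links\<close> only if its pairs have many extensions. Codegrees are
      taken in \<open>E\<close> and the copy is sought in \<open>E\<close>, so one round of pruning
      suffices.\<close>
    define heavy where "heavy x y \<longleftrightarrow> \<beta> * N \<le> card {z \<in> V. {x, y, z} \<in> E}" for x y
    define E1 where "E1 x y z \<longleftrightarrow> {x, y, z} \<in> E \<and> x \<notin> U \<and> y \<notin> U \<and> z \<notin> U \<and>
      heavy x y \<and> heavy y z \<and> heavy x z" for x y z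
    have heavy_sym: "heavy x y \<longleftrightarrow> heavy y x" for x y
      by (simp add: heavy_def insert_commute)
    have sym12: "E1 x y z \<Longrightarrow> E1 y x z" and sym23: "E1 x y z \<Longrightarrow> E1 x z y" for x y z
      using heavy_sym unfolding E1_def by (auto simp: insert_commute)
    interpret sparse_links V E1 g N
    proof
      fix x y z assume xyz: "x \<in> V" "y \<in> V" "z \<in> V" "E1 x y z"
      define P where "P = {(u, v) \<in> V \<times> V. E1 u v x \<and> E1 u v y}"
      define R where "R = {((a, b), w) \<in> (V \<times> V) \<times> V. {a, b, x} \<in> E \<and> {a, b, y} \<in> E \<and> {a, b, w} \<in> E}"
      have finP: "finite P" using fin finite_subset[of P "V \<times> V"] by (auto simp: P_def)
      have "card P \<le> g * N\<^sup>2"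
      proof (rule ccontr)
        assume "\<not> ?thesis"
        then have P: "g * N\<^sup>2 \<le> card P" by simp
        have "g * \<beta> * N ^ 3 = g * N\<^sup>2 * (\<beta> * N)" by (simp add: power2_eq_square power3_eq_cube)
        also have "\<dots> \<le> card P * (\<beta> * N)" using P \<beta> N by (intro mult_right_mono) auto
        also have "\<dots> = (\<Sum>p\<in>P. \<beta> * N)" by simp
        also have "\<dots> \<le> (\<Sum>p\<in>P. real (card {w \<in> V. {fst p, snd p, w} \<in> E}))"
          by (intro sum_mono) (auto simp: P_def E1_def heavy_def)
        also have "\<dots> = card (SIGMA p:P. {w \<in> V. {fst p, snd p, w} \<in> E})"
          using finP fin by (simp add: card_SigmaI)
        also have "\<dots> \<le> card R"
        proof -
          have "finite R" using fin finite_subset[of R "(V \<times> V) \<times> V"] by (auto simp: R_def)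
          moreover have "(SIGMA p:P. {w \<in> V. {fst p, snd p, w} \<in> E}) \<subseteq> R"
            by (auto simp: P_def R_def E1_def)
          ultimately show ?thesis by (simp add: card_mono)
        qed
        finally have "\<exists>P\<subseteq>V - U. is_copy (F5S m) E P"
          using n1[rule_format, of V E x y z U] fin n E xyz U unfolding R_def N_def E1_def by auto
        then show False using free by contradiction
      qed
      then show "(\<Sum>u\<in>V. \<Sum>v\<in>V. of_bool (E1 u v x \<and> E1 u v y)) \<le> g * N\<^sup>2"
        using sum_pairs_of_bool[OF fin] by (simp add: P_def)
    qed (rule fin N_def N g | erule sym12 sym23)+
    have "6 * real (card E) \<le> total + 3 * (K * N\<^sup>2) + 3 * (N\<^sup>2 * (\<beta> * N))"
    proof -
      define a where "a x = (of_bool (x \<in> U) :: real)" for x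
      define l where "l x y z = (of_bool (\<not> heavy x y \<and> {x, y, z} \<in> E) :: real)" for x y z
      have main: "(\<Sum>x\<in>V. \<Sum>y\<in>V. \<Sum>z\<in>V. of_bool ({x, y, z} \<in> E)) \<le>
          (\<Sum>x\<in>V. \<Sum>y\<in>V. \<Sum>z\<in>V. of_bool (E1 x y z) + (a x + a y + a z) + (l x y z + l y z x + l x z y))"
      proof (intro sum_mono)
        fix x y z :: 'a
        have eqs: "{y, z, x} = {x, y, z}" "{x, z, y} = {x, y, z}" by (simp_all add: insert_commute)
        have nn: "0 \<le> a x" "0 \<le> a y" "0 \<le> a z" "0 \<le> l x y z" "0 \<le> l y z x" "0 \<le> l x z y"
          by (simp_all add: a_def l_def)
        have "1 \<le> a x + a y + a z + (l x y z + l y z x + l x z y)"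
          if "{x, y, z} \<in> E" "\<not> E1 x y z"
        proof -
          have "a x = 1 \<or> a y = 1 \<or> a z = 1 \<or> l x y z = 1 \<or> l y z x = 1 \<or> l x z y = 1"
            using that unfolding E1_def a_def l_def eqs by simp
          then show ?thesis using nn by linarith
        qed
        then show "of_bool ({x, y, z} \<in> E) \<le>
            of_bool (E1 x y z) + (a x + a y + a z) + (l x y z + l y z x + l x z y)"
          using nn by (cases "{x, y, z} \<in> E"; cases "E1 x y z") auto
      qed
      have sa: "(\<Sum>x\<in>V. a x) \<le> K"
        using U fin by (simp add: a_def sum_of_bool_eq Int_absorb1 flip: Int_def)
      have "(\<Sum>x\<in>V. \<Sum>y\<in>V. \<Sum>z\<in>V. a x) = N\<^sup>2 * (\<Sum>x\<in>V. a x)"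
        "(\<Sum>x\<in>V. \<Sum>y\<in>V. \<Sum>z\<in>V. a y) = N\<^sup>2 * (\<Sum>x\<in>V. a x)"
        "(\<Sum>x\<in>V. \<Sum>y\<in>V. \<Sum>z\<in>V. a z) = N\<^sup>2 * (\<Sum>x\<in>V. a x)"
        by (simp_all add: N_def sum_distrib_left power2_eq_square mult.assoc)
      note sums_a = this
      have sl: "(\<Sum>z\<in>V. l x y z) \<le> \<beta> * N" for x y
      proof (cases "heavy x y")
        case False
        then show ?thesis using fin
          by (simp add: l_def heavy_def sum_of_bool_eq Int_def)
      qed (use \<beta> N in \<open>simp add: l_def\<close>)
      have "(\<Sum>x\<in>V. \<Sum>y\<in>V. \<Sum>z\<in>V. l x y z) \<le> (\<Sum>x\<in>V. \<Sum>y\<in>V. \<beta> * N)"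
        by (intro sum_mono sl)
      then have l1: "(\<Sum>x\<in>V. \<Sum>y\<in>V. \<Sum>z\<in>V. l x y z) \<le> N\<^sup>2 * (\<beta> * N)"
        by (simp add: N_def power2_eq_square)
      have l2: "(\<Sum>x\<in>V. \<Sum>y\<in>V. \<Sum>z\<in>V. l y z x) = (\<Sum>x\<in>V. \<Sum>y\<in>V. \<Sum>z\<in>V. l x y z)"
        by (rule sum_swap3[symmetric])
      have l3: "(\<Sum>x\<in>V. \<Sum>y\<in>V. \<Sum>z\<in>V. l x z y) = (\<Sum>x\<in>V. \<Sum>y\<in>V. \<Sum>z\<in>V. l x y z)"
        by (rule sum.cong[OF refl sum.swap])
      have "N\<^sup>2 * (\<Sum>x\<in>V. a x) \<le> N\<^sup>2 * K" using sa by (intro mult_left_mono) auto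
      moreover have "6 * real (card E) \<le> total + (N\<^sup>2 * (\<Sum>x\<in>V. a x) + N\<^sup>2 * (\<Sum>x\<in>V. a x) +
          N\<^sup>2 * (\<Sum>x\<in>V. a x)) + ((\<Sum>x\<in>V. \<Sum>y\<in>V. \<Sum>z\<in>V. l x y z) +
          (\<Sum>x\<in>V. \<Sum>y\<in>V. \<Sum>z\<in>V. l x y z) + (\<Sum>x\<in>V. \<Sum>y\<in>V. \<Sum>z\<in>V. l x y z))"
        using main sum_ordered_triples[OF fin, of E] E by (simp only: sum.distrib sums_a total_def l2 l3)
      ultimately show ?thesis using l1 by (simp add: mult.commute)
    qed
    moreover have "3 * (K * N\<^sup>2) \<le> g / 2 * N ^ 3"
    proof -
      have "6 * real K / g \<le> N" using n2 n by (simp add: N_def)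
      then have "3 * real K \<le> g / 2 * N" using g by (simp add: field_simps)
      then have "3 * real K * N\<^sup>2 \<le> g / 2 * N * N\<^sup>2" by (intro mult_right_mono) auto
      then show ?thesis by (simp add: power2_eq_square power3_eq_cube)
    qed
    moreover have "6 * ((1 / 27 - \<theta>) * N ^ 3) \<le> 6 * real (card E)" using big by (simp add: N_def)
    ultimately have "(2 / 9 - g) * N ^ 3 \<le> total"
      by (simp add: \<theta>_def \<beta>_def power2_eq_square power3_eq_cube field_simps)
    then obtain c :: "'a \<Rightarrow> nat" where c: "\<forall>x. c x < 3" and tr: "(2 / 9 - 301 * g) * N ^ 3 \<le>
      (\<Sum>x\<in>V. \<Sum>y\<in>V. \<Sum>z\<in>V. of_bool (E1 x y z \<and> c x \<noteq> c y \<and> c y \<noteq> c z \<and> c x \<noteq> c z))"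
      using tripartition by blast
    have "6 * ((1 / 27 - \<eta>) * N ^ 3) \<le> (2 / 9 - 301 * g) * N ^ 3"
    proof -
      have "6 * (1 / 27 - \<eta>) \<le> 2 / 9 - 301 * g" using g by simp
      then show ?thesis using N mult_right_mono[of _ _ "N ^ 3"] by fastforce
    qed
    also note tr
    also have "(\<Sum>x\<in>V. \<Sum>y\<in>V. \<Sum>z\<in>V. of_bool (E1 x y z \<and> c x \<noteq> c y \<and> c y \<noteq> c z \<and> c x \<noteq> c z)) \<le>
      (\<Sum>x\<in>V. \<Sum>y\<in>V. \<Sum>z\<in>V. (of_bool ({x, y, z} \<in> {e \<in> E. inj_on c e}) :: real))"
      by (intro sum_mono) (auto simp: E1_def inj_on_def)
    also have "\<dots> = 6 * real (card {e \<in> E. inj_on c e})"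
      using E by (intro sum_ordered_triples[OF fin]) auto
    finally show "\<exists>c :: 'a \<Rightarrow> nat. (\<forall>x. c x < 3) \<and> (1 / 27 - \<eta>) * card V ^ 3 \<le> card {e \<in> E. inj_on c e}"
      using c by (intro exI[of _ c]) (simp add: N_def)
  qed
qed

section \<open>Graphs with a near-optimal colouring\<close>

lemma card_bij_betw_filter:
  assumes "bij_betw f A B"
  shows "card {p \<in> A. f p \<in> S} = card {e \<in> B. e \<in> S}"
proof (rule bij_betw_same_card)
  show "bij_betw f {p \<in> A. f p \<in> S} {e \<in> B. e \<in> S}"
    using assms by (auto simp: bij_betw_def inj_on_def)
qed

lemma third_colour:
  fixes i j k l :: nat
  assumes "i < 3" "j < 3" "k < 3" "l < 3" "i \<noteq> j" "i \<noteq> k" "j \<noteq> k" "l \<noteq> i" "l \<noteq> j"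
  shows "l = k"
  using assms by linarith

lemma other_colours:
  fixes i :: nat
  assumes "i < 3"
  obtains j k where "j < 3" "k < 3" "i \<noteq> j" "i \<noteq> k" "j \<noteq> k"
proof -
  have "i = 0 \<or> i = 1 \<or> i = 2" using assms by linarith
  then show ?thesis using that[of 1 2] that[of 0 2] that[of 0 1] by auto
qed

lemma sum_degrees_le:
  assumes "finite S" "\<And>e. e \<in> S \<Longrightarrow> card e = 3" "finite Y"
  shows "(\<Sum>x\<in>Y. card {e \<in> S. x \<in> e}) \<le> 3 * card S"
proof -
  have "(\<Sum>x\<in>Y. card {e \<in> S. x \<in> e}) = (\<Sum>e\<in>S. card {x \<in> Y. x \<in> e})"
    using sum.swap_restrict[OF assms(3,1), of "\<lambda>_ _. 1 :: nat" "\<lambda>x e. x \<in> e"] by simp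
  also have "\<dots> \<le> (\<Sum>e\<in>S. 3)"
  proof (rule sum_mono)
    fix e assume "e \<in> S"
    then have "card e = 3" by (rule assms)
    then have "card {x \<in> Y. x \<in> e} \<le> card e" by (intro card_mono card_ge_0_finite) auto
    then show "card {x \<in> Y. x \<in> e} \<le> 3" using \<open>card e = 3\<close> by simp
  qed
  finally show ?thesis by simp
qed

lemma card_edges_through_pair:
  assumes "finite V" "\<And>e. e \<in> S \<Longrightarrow> e \<subseteq> V \<and> card e = 3" "x \<noteq> u"
  shows "card {e \<in> S. x \<in> e \<and> u \<in> e} \<le> card V"
proof -
  have "{e \<in> S. x \<in> e \<and> u \<in> e} \<subseteq> (\<lambda>w. {x, u, w}) ` V"
  proof
    fix e assume e: "e \<in> {e \<in> S. x \<in> e \<and> u \<in> e}"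
    then have "card e = 3" "e \<subseteq> V" using assms(2) by auto
    have "card (e - {x, u}) = 1"
      using e \<open>card e = 3\<close> assms(3) by (subst card_Diff_subset) auto
    then obtain w where "e - {x, u} = {w}" by (auto simp: card_1_singleton_iff)
    then have "e = {x, u, w}" "w \<in> V" using e \<open>e \<subseteq> V\<close> by auto
    then show "e \<in> (\<lambda>w. {x, u, w}) ` V" by blast
  qed
  then have "card {e \<in> S. x \<in> e \<and> u \<in> e} \<le> card ((\<lambda>w. {x, u, w}) ` V)"
    using assms(1) by (intro card_mono) auto
  also have "\<dots> \<le> card V" by (rule card_image_le[OF assms(1)])
  finally show ?thesis .
qed

lemma card_edges_through_vertex_meeting:
  assumes "finite V" "\<And>e. e \<in> S \<Longrightarrow> e \<subseteq> V \<and> card e = 3" "finite Z" "x \<notin> Z"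
  shows "card {e \<in> S. x \<in> e \<and> e \<inter> Z \<noteq> {}} \<le> card Z * card V"
proof -
  have finS: "finite S" using finite_subset[of S "Pow V"] assms by auto
  have "{e \<in> S. x \<in> e \<and> e \<inter> Z \<noteq> {}} = (\<Union>u\<in>Z. {e \<in> S. x \<in> e \<and> u \<in> e})" by auto
  then have "card {e \<in> S. x \<in> e \<and> e \<inter> Z \<noteq> {}} \<le> (\<Sum>u\<in>Z. card {e \<in> S. x \<in> e \<and> u \<in> e})"
    using card_UN_le[OF assms(3)] by simp
  also have "\<dots> \<le> (\<Sum>u\<in>Z. card V)"
    using assms by (intro sum_mono card_edges_through_pair) auto
  finally show ?thesis by simp
qed

locale coloured =
  fixes V :: "'a set" and E :: "'a set set" and c :: "'a \<Rightarrow> nat"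
  assumes fin: "finite V" and edge: "e \<in> E \<Longrightarrow> e \<subseteq> V \<and> card e = 3" and c3: "c x < 3"
begin

definition cls :: "nat \<Rightarrow> 'a set" where
  "cls i = {x \<in> V. c x = i}"

definition rainbow :: "'a set set" where
  "rainbow = {e. e \<subseteq> V \<and> card e = 3 \<and> inj_on c e}"

definition missing :: "'a set set" where
  "missing = rainbow - E"

definition tdeg :: "'a \<Rightarrow> nat" where
  "tdeg x = card {e \<in> E. x \<in> e \<and> inj_on c e}"

definition mdeg :: "'a \<Rightarrow> nat" where
  "mdeg x = card {e \<in> missing. x \<in> e}"

definition bdeg :: "'a \<Rightarrow> nat" where
  "bdeg x = card {e \<in> E. x \<in> e \<and> \<not> inj_on c e}"

lemma finite_edges: "finite E"
  using finite_subset[of E "Pow V"] edge fin by auto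

lemma finite_rainbow: "finite rainbow"
  using finite_subset[of rainbow "Pow V"] fin by (auto simp: rainbow_def)

lemma finite_cls: "finite (cls i)"
  using fin by (simp add: cls_def)

lemma rainbowI:
  assumes "a \<in> cls i" "b \<in> cls j" "d \<in> cls k" "i \<noteq> j" "i \<noteq> k" "j \<noteq> k"
  shows "{a, b, d} \<in> rainbow"
proof -
  have "a \<noteq> b" "a \<noteq> d" "b \<noteq> d" using assms by (auto simp: cls_def)
  then show ?thesis using assms by (auto simp: cls_def rainbow_def inj_on_def)
qed

text \<open>Fixing the order of the two other colours removes the symmetry of a triple, so degrees
  turn into counts of pairs in a product of two classes.\<close>

lemma rainbow_through:
  assumes "x \<in> V" "j < 3" "k < 3" "c x \<noteq> j" "c x \<noteq> k" "j \<noteq> k"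
  shows "bij_betw (\<lambda>p. {fst p, snd p, x}) (cls j \<times> cls k) {e \<in> rainbow. x \<in> e}"
  unfolding bij_betw_def
proof (intro conjI equalityI subsetI)
  show "inj_on (\<lambda>p. {fst p, snd p, x}) (cls j \<times> cls k)"
  proof (rule inj_onI)
    fix p q assume cl: "p \<in> cls j \<times> cls k" "q \<in> cls j \<times> cls k"
      and eq: "{fst p, snd p, x} = {fst q, snd q, x}"
    have "fst p \<in> {fst q, snd q, x}" "snd p \<in> {fst q, snd q, x}" using eq by blast+
    moreover have "c (fst p) = j" "c (snd p) = k" "c (fst q) = j" "c (snd q) = k"
      using cl by (auto simp: cls_def)
    ultimately have "fst p = fst q" "snd p = snd q" using assms by (metis insert_iff empty_iff)+
    then show "p = q" by (rule prod_eqI)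
  qed
next
  fix e assume "e \<in> (\<lambda>p. {fst p, snd p, x}) ` (cls j \<times> cls k)"
  then obtain a b where ab: "a \<in> cls j" "b \<in> cls k" "e = {a, b, x}" by auto
  have "x \<in> cls (c x)" using assms by (simp add: cls_def)
  then show "e \<in> {e \<in> rainbow. x \<in> e}" using rainbowI[of a j b k x "c x"] ab assms by auto
next
  fix e assume "e \<in> {e \<in> rainbow. x \<in> e}"
  then have e: "e \<subseteq> V" "card e = 3" "inj_on c e" "x \<in> e" by (auto simp: rainbow_def)
  have "card (e - {x}) = 2" using e by simp
  then obtain p q where pq: "e - {x} = {p, q}" "p \<noteq> q" by (auto simp: card_2_iff)
  have pqe: "p \<in> e" "q \<in> e" "p \<noteq> x" "q \<noteq> x" "e = {p, q, x}" using pq e by auto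
  have col: "c p \<noteq> c q" "c p \<noteq> c x" "c q \<noteq> c x" using e pq pqe by (auto dest: inj_onD)
  have "(c p = j \<and> c q = k) \<or> (c p = k \<and> c q = j)"
    using col assms c3[of p] c3[of q] c3[of x] by linarith
  then have "(p, q) \<in> cls j \<times> cls k \<or> (q, p) \<in> cls j \<times> cls k" using pqe e by (auto simp: cls_def)
  then show "e \<in> (\<lambda>p. {fst p, snd p, x}) ` (cls j \<times> cls k)"
    using pqe(5) by (auto simp: insert_commute image_iff Bex_def)
qed

lemma rainbow_bij:
  assumes "i < 3" "j < 3" "k < 3" "i \<noteq> j" "i \<noteq> k" "j \<noteq> k"
  shows "bij_betw (\<lambda>p. {fst (fst p), snd (fst p), snd p}) ((cls j \<times> cls k) \<times> cls i) rainbow"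
  unfolding bij_betw_def
proof (intro conjI equalityI subsetI)
  show "inj_on (\<lambda>p. {fst (fst p), snd (fst p), snd p}) ((cls j \<times> cls k) \<times> cls i)"
  proof (rule inj_onI)
    fix p q assume cl: "p \<in> (cls j \<times> cls k) \<times> cls i" "q \<in> (cls j \<times> cls k) \<times> cls i"
      and eq: "{fst (fst p), snd (fst p), snd p} = {fst (fst q), snd (fst q), snd q}" (is "_ = ?Q")
    have "fst (fst p) \<in> ?Q" "snd (fst p) \<in> ?Q" "snd p \<in> ?Q" using eq by blast+
    moreover have "c (fst (fst p)) = j" "c (snd (fst p)) = k" "c (snd p) = i"
        "c (fst (fst q)) = j" "c (snd (fst q)) = k" "c (snd q) = i"
      using cl by (auto simp: cls_def)
    ultimately have "fst (fst p) = fst (fst q)" "snd (fst p) = snd (fst q)" "snd p = snd q"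
      using assms by (metis insert_iff empty_iff)+
    then show "p = q" by (simp add: prod_eq_iff)
  qed
next
  fix e assume "e \<in> (\<lambda>p. {fst (fst p), snd (fst p), snd p}) ` ((cls j \<times> cls k) \<times> cls i)"
  then show "e \<in> rainbow" using rainbowI[of _ j _ k _ i] assms by auto
next
  fix e assume "e \<in> rainbow"
  then have e: "e \<subseteq> V" "card e = 3" "inj_on c e" by (auto simp: rainbow_def)
  have "card (c ` e) = 3" using e card_image by metis
  moreover have "c ` e \<subseteq> {..<3}" using c3 by auto
  ultimately have "c ` e = {..<3}" by (intro card_subset_eq) auto
  then have "i \<in> c ` e" using assms by simp
  then obtain x where x: "x \<in> e" "c x = i" by auto
  then have "e \<in> (\<lambda>p. {fst p, snd p, x}) ` (cls j \<times> cls k)"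
    using rainbow_through[of x j k] assms e \<open>e \<in> rainbow\<close> by (auto simp: bij_betw_def)
  then obtain p where "p \<in> cls j \<times> cls k" "e = {fst p, snd p, x}" by blast
  moreover have "x \<in> cls i" using x e by (auto simp: cls_def)
  ultimately show "e \<in> (\<lambda>p. {fst (fst p), snd (fst p), snd p}) ` ((cls j \<times> cls k) \<times> cls i)"
    by (intro image_eqI[where x = "(p, x)"]) simp_all
qed

lemma card_rainbow:
  assumes "i < 3" "j < 3" "k < 3" "i \<noteq> j" "i \<noteq> k" "j \<noteq> k"
  shows "card rainbow = card (cls i) * card (cls j) * card (cls k)"
  using bij_betw_same_card[OF rainbow_bij[OF assms]] by (simp add: card_cartesian_product mult_ac)

lemma tdeg_eq:
  assumes "x \<in> V" "j < 3" "k < 3" "c x \<noteq> j" "c x \<noteq> k" "j \<noteq> k"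
  shows "tdeg x = card {p \<in> cls j \<times> cls k. {fst p, snd p, x} \<in> E}"
proof -
  have "{e \<in> E. x \<in> e \<and> inj_on c e} = {e \<in> {e \<in> rainbow. x \<in> e}. e \<in> E}"
    using edge by (auto simp: rainbow_def)
  then show ?thesis unfolding tdeg_def
    using card_bij_betw_filter[OF rainbow_through[OF assms], of E] by simp
qed

lemma mdeg_eq:
  assumes "x \<in> V" "j < 3" "k < 3" "c x \<noteq> j" "c x \<noteq> k" "j \<noteq> k"
  shows "mdeg x = card {p \<in> cls j \<times> cls k. {fst p, snd p, x} \<notin> E}"
proof -
  have "{e \<in> missing. x \<in> e} = {e \<in> {e \<in> rainbow. x \<in> e}. e \<in> - E}"
    by (auto simp: missing_def)
  then show ?thesis unfolding mdeg_def
    using card_bij_betw_filter[OF rainbow_through[OF assms], of "- E"] by simp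
qed

lemma tdeg_mdeg:
  assumes "x \<in> V" "j < 3" "k < 3" "c x \<noteq> j" "c x \<noteq> k" "j \<noteq> k"
  shows "tdeg x + mdeg x = card (cls j) * card (cls k)"
proof -
  have "cls j \<times> cls k = {p \<in> cls j \<times> cls k. {fst p, snd p, x} \<in> E} \<union> {p \<in> cls j \<times> cls k. {fst p, snd p, x} \<notin> E}"
    by auto
  then have "card (cls j \<times> cls k) = tdeg x + mdeg x"
    unfolding tdeg_eq[OF assms] mdeg_eq[OF assms] using finite_cls
    by (subst card_Un_disjoint[symmetric]) (auto intro!: arg_cong[where f = card])
  then show ?thesis by (simp add: card_cartesian_product)
qed

text \<open>At most \<open>mdeg x'\<close> pairs of the transversal link of \<open>x\<close> are
  absent from that of \<open>x'\<close>. Every remaining pair extends by every vertex of their own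
  class, except at missing triples.\<close>

lemma common_link_count:
  fixes \<rho> \<eta> n :: real
  assumes x: "x \<in> V" "x' \<in> V" "c x = c x'"
    and deg: "mdeg x' + \<rho> * n\<^sup>2 \<le> tdeg x"
    and miss: "card missing \<le> \<eta> * n ^ 3"
    and cls: "n / 28 \<le> card (cls (c x))" and nn: "0 \<le> \<rho>" "0 \<le> n"
  shows "(\<rho> / 28 - \<eta>) * n ^ 3 \<le> card {((a, b), u) \<in> (V \<times> V) \<times> V. {a, b, x} \<in> E \<and> {a, b, x'} \<in> E \<and> {a, b, u} \<in> E}"
    (is "_ \<le> real (card ?R)")
proof -
  obtain j k where jk: "j < 3" "k < 3" "c x \<noteq> j" "c x \<noteq> k" "j \<noteq> k"
    using other_colours[OF c3[of x]] by metis
  define P where "P = {p \<in> cls j \<times> cls k. {fst p, snd p, x} \<in> E \<and> {fst p, snd p, x'} \<in> E}"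
  have fin2: "finite (cls j \<times> cls k)" using finite_cls by auto
  have finP: "finite P" by (rule finite_subset[OF _ fin2]) (auto simp: P_def)
  have "{p \<in> cls j \<times> cls k. {fst p, snd p, x} \<in> E} \<subseteq> P \<union> {p \<in> cls j \<times> cls k. {fst p, snd p, x'} \<notin> E}"
    by (auto simp: P_def)
  then have "card {p \<in> cls j \<times> cls k. {fst p, snd p, x} \<in> E} \<le> card (P \<union> {p \<in> cls j \<times> cls k. {fst p, snd p, x'} \<notin> E})"
    by (intro card_mono finite_UnI finP finite_subset[OF _ fin2]) auto
  also have "\<dots> \<le> card P + card {p \<in> cls j \<times> cls k. {fst p, snd p, x'} \<notin> E}" by (rule card_Un_le)
  finally have "tdeg x \<le> card P + mdeg x'"
    using tdeg_eq[of x j k] mdeg_eq[of x' j k] x jk by simp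
  then have P: "\<rho> * n\<^sup>2 \<le> card P" using deg by linarith
  define M where "M = {p \<in> (cls j \<times> cls k) \<times> cls (c x). {fst (fst p), snd (fst p), snd p} \<in> - E}"
  have M: "card M = card missing"
  proof -
    have "missing = {e \<in> rainbow. e \<in> - E}" by (auto simp: missing_def)
    moreover have "bij_betw (\<lambda>p. {fst (fst p), snd (fst p), snd p}) ((cls j \<times> cls k) \<times> cls (c x)) rainbow"
      by (rule rainbow_bij) (use jk c3 in auto)
    ultimately show ?thesis unfolding M_def by (simp only: card_bij_betw_filter)
  qed
  have fin3: "finite ((cls j \<times> cls k) \<times> cls (c x))" using finite_cls by auto
  have "P \<times> cls (c x) \<subseteq> ?R \<union> M" by (auto simp: P_def M_def cls_def)
  then have "card (P \<times> cls (c x)) \<le> card (?R \<union> M)"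
    using fin3 by (intro card_mono finite_UnI finite_subset[of ?R "(V \<times> V) \<times> V"] finite_subset[of M])
      (auto simp: M_def fin)
  also have "\<dots> \<le> card ?R + card M" by (rule card_Un_le)
  finally have "real (card P) * card (cls (c x)) \<le> card ?R + card missing"
    using M by (simp add: card_cartesian_product flip: of_nat_mult of_nat_add)
  moreover have "\<rho> * n\<^sup>2 * (n / 28) \<le> real (card P) * card (cls (c x))"
    using P cls nn by (intro mult_mono) auto
  ultimately show ?thesis using miss
    by (simp add: power2_eq_square power3_eq_cube left_diff_distrib)
qed

end

section \<open>Non-transversal edges under an optimal colouring\<close>

lemma amgm3:
  fixes a b c :: real
  assumes "0 \<le> a" "0 \<le> b" "0 \<le> c"
  shows "27 * (a * b * c) \<le> (a + b + c) ^ 3"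
proof -
  have "0 \<le> (a + b + c) * ((a - b)\<^sup>2 + (b - c)\<^sup>2 + (a - c)\<^sup>2)"
    using assms by (intro mult_nonneg_nonneg add_nonneg_nonneg) auto
  moreover have "0 \<le> a * (b - c)\<^sup>2 + b * (a - c)\<^sup>2 + c * (a - b)\<^sup>2"
    using assms by (intro add_nonneg_nonneg mult_nonneg_nonneg) auto
  moreover have "(a + b + c) ^ 3 * 2 = 54 * (a * b * c) + (a + b + c) * ((a - b)\<^sup>2 + (b - c)\<^sup>2 + (a - c)\<^sup>2) +
      6 * (a * (b - c)\<^sup>2 + b * (a - c)\<^sup>2 + c * (a - b)\<^sup>2)"
    by (simp add: power2_eq_square power3_eq_cube algebra_simps)
  moreover have "27 * X \<le> Y" if "0 \<le> p" "0 \<le> q" "Y * 2 = 54 * X + p + 6 * q" for X Y p q :: real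
    using that by simp
  ultimately show ?thesis by blast
qed

context coloured
begin

lemma card_rainbow_split: "card rainbow = card {e \<in> E. inj_on c e} + card missing"
proof -
  have "{e \<in> E. inj_on c e} = rainbow \<inter> E" using edge by (auto simp: rainbow_def)
  then show ?thesis
    unfolding missing_def using finite_rainbow by (metis card_Int_Diff)
qed

lemma card_classes: "card (cls 0) + card (cls 1) + card (cls 2) = card V"
proof -
  have "V = cls 0 \<union> cls 1 \<union> cls 2"
  proof
    show "V \<subseteq> cls 0 \<union> cls 1 \<union> cls 2"
    proof
      fix x assume "x \<in> V"
      moreover have "c x = 0 \<or> c x = 1 \<or> c x = 2" using c3[of x] by linarith
      ultimately show "x \<in> cls 0 \<union> cls 1 \<union> cls 2" by (auto simp: cls_def)
    qed
  qed (auto simp: cls_def)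
  then have "card V = card (cls 0 \<union> cls 1 \<union> cls 2)" by simp
  also have "\<dots> = card (cls 0 \<union> cls 1) + card (cls 2)"
    by (rule card_Un_disjoint) (auto simp: finite_cls, auto simp: cls_def)
  also have "card (cls 0 \<union> cls 1) = card (cls 0) + card (cls 1)"
    by (rule card_Un_disjoint) (auto simp: finite_cls, auto simp: cls_def)
  finally show ?thesis by simp
qed

lemma card_cls_le: "card (cls i) \<le> card V"
  using fin by (auto simp: cls_def intro: card_mono)

lemma card_rainbow_le: "27 * real (card rainbow) \<le> real (card V) ^ 3"
  using amgm3[of "card (cls 0)" "card (cls 1)" "card (cls 2)"] card_classes
    card_rainbow[of 0 1 2] by (simp flip: of_nat_add of_nat_mult)

end

text \<open>Constants: 192 = 3 * 4 * 16 leaves at most a \<open>\<mu> / 4\<close> share of vertices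
  with \<open>mdeg\<close> above \<open>\<mu> / 16\<close> n^2; 1/28 is a round value below 1/27 for
  products of class sizes; 448 = 2 * 8 * 28 is what \<open>common_link_count\<close> leaves of
  \<open>\<mu> / 8\<close>; 672 = 6 * 112 is for the final double count. \<open>K\<close> bounds the
  sets that a copy may be asked to avoid.\<close>

locale near_extremal = coloured V E c for V :: "'a set" and E c +
  fixes m K :: nat and \<mu> n :: real
  assumes n_def: "n = card V" and n_pos: "0 < n" and m2: "2 \<le> m"
    and \<mu>: "0 < \<mu>" "\<mu> \<le> 1 / 672" and K_le: "4 * real K \<le> \<mu> * n"
    and many: "(1 / 27 - \<mu>\<^sup>2 / 192) * n ^ 3 \<le> card {e \<in> E. inj_on c e}"
    and best: "\<And>c' :: 'a \<Rightarrow> nat. (\<And>x. c' x < 3) \<Longrightarrow> card {e \<in> E. inj_on c' e} \<le> card {e \<in> E. inj_on c e}"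
    and finder: "\<And>W x y z. \<lbrakk>{x, y, z} \<in> E; {x, y, z} \<subseteq> V - W; W \<subseteq> V; card W \<le> K;
      \<mu> / 448 * n ^ 3 \<le> card {((a, b), u) \<in> (V \<times> V) \<times> V. {a, b, x} \<in> E \<and> {a, b, y} \<in> E \<and> {a, b, u} \<in> E}\<rbrakk>
      \<Longrightarrow> \<exists>U\<subseteq>V - W. is_copy (F5S m) E U"
begin

lemma \<mu>_sq: "\<mu>\<^sup>2 / 192 \<le> \<mu> / 448" "\<mu>\<^sup>2 / 192 \<le> 1 / 756"
proof -
  have "\<mu>\<^sup>2 \<le> \<mu> * (1 / 672)" unfolding power2_eq_square using \<mu> by (intro mult_left_mono) auto
  then show "\<mu>\<^sup>2 / 192 \<le> \<mu> / 448" "\<mu>\<^sup>2 / 192 \<le> 1 / 756" using \<mu> by auto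
qed

lemma missing_le: "card missing \<le> \<mu>\<^sup>2 / 192 * n ^ 3"
  using card_rainbow_le many card_rainbow_split by (simp add: n_def algebra_simps)

lemma cls_product:
  assumes "i < 3" "j < 3" "k < 3" "i \<noteq> j" "i \<noteq> k" "j \<noteq> k"
  shows "n ^ 3 / 28 \<le> real (card (cls i)) * card (cls j) * card (cls k)"
proof -
  have "n ^ 3 / 28 \<le> (1 / 27 - \<mu>\<^sup>2 / 192) * n ^ 3"
    using \<mu>_sq n_pos mult_right_mono[of "1 / 28" "1 / 27 - \<mu>\<^sup>2 / 192" "n ^ 3"] by simp
  also have "\<dots> \<le> card rainbow" using many card_rainbow_split by simp
  finally show ?thesis by (simp add: card_rainbow[OF assms])
qed

lemma cls_pair_lower:
  assumes "j < 3" "k < 3" "j \<noteq> k"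
  shows "n\<^sup>2 / 28 \<le> real (card (cls j)) * card (cls k)"
proof -
  obtain i where i: "i < 3" "i \<noteq> j" "i \<noteq> k"
    using assms other_colours[of j] by (metis)
  have "n * (n\<^sup>2 / 28) = n ^ 3 / 28" by (simp add: power2_eq_square power3_eq_cube)
  also have "\<dots> \<le> real (card (cls i)) * (real (card (cls j)) * card (cls k))"
    using cls_product[of i j k] assms i by (simp add: mult.assoc)
  also have "\<dots> \<le> n * (real (card (cls j)) * card (cls k))"
    using card_cls_le[of i] by (intro mult_right_mono) (auto simp: n_def)
  finally show ?thesis using n_pos by simp
qed

lemma cls_lower:
  assumes "i < 3"
  shows "n / 28 \<le> card (cls i)"
proof -
  obtain j k where jk: "j < 3" "k < 3" "i \<noteq> j" "i \<noteq> k" "j \<noteq> k" using other_colours[OF assms] by metis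
  have "n * (n / 28) \<le> real (card (cls i)) * card (cls j)"
    using cls_pair_lower[of i j] assms jk by (simp add: power2_eq_square)
  also have "\<dots> \<le> real (card (cls i)) * n" using card_cls_le[of j] by (intro mult_left_mono) (auto simp: n_def)
  finally show ?thesis using n_pos by (simp add: mult.commute)
qed

text \<open>The main source of copies: two vertices of one class on a common edge. The hypothesis is
  asymmetric, so nothing need be known about the missing degree of \<open>x\<close>.\<close>

lemma copy_if_degree:
  assumes "{x, x', z} \<in> E" "{x, x', z} \<subseteq> V - W" "W \<subseteq> V" "card W \<le> K" "c x = c x'"
    and "mdeg x' + \<mu> / 8 * n\<^sup>2 \<le> tdeg x"
  shows "\<exists>U\<subseteq>V - W. is_copy (F5S m) E U"
proof (rule finder[OF assms(1-4)])
  have "\<mu> / 448 * n ^ 3 \<le> (\<mu> / 8 / 28 - \<mu>\<^sup>2 / 192) * n ^ 3"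
    using \<mu>_sq n_pos by (intro mult_right_mono) auto
  also have "\<dots> \<le> card {((a, b), u) \<in> (V \<times> V) \<times> V. {a, b, x} \<in> E \<and> {a, b, x'} \<in> E \<and> {a, b, u} \<in> E}"
    using assms \<mu> n_pos by (intro common_link_count missing_le cls_lower c3) auto
  finally show "\<mu> / 448 * n ^ 3 \<le>
      card {((a, b), u) \<in> (V \<times> V) \<times> V. {a, b, x} \<in> E \<and> {a, b, x'} \<in> E \<and> {a, b, u} \<in> E}" .
qed

lemma finite_missing: "finite missing"
  using finite_rainbow by (simp add: missing_def)

lemma missing_edge: "e \<in> missing \<Longrightarrow> e \<subseteq> V \<and> card e = 3"
  by (simp add: missing_def rainbow_def)

lemma card_atypical_le:
  "card {x \<in> V. \<mu> / 16 * n\<^sup>2 \<le> mdeg x} \<le> \<mu> / 4 * n"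
proof -
  define X where "X = {x \<in> V. \<mu> / 16 * n\<^sup>2 \<le> mdeg x}"
  have "card X * (\<mu> / 16 * n\<^sup>2) \<le> (\<Sum>x\<in>X. real (mdeg x))"
    using sum_bounded_below[of X "\<mu> / 16 * n\<^sup>2" "\<lambda>x. real (mdeg x)"] by (simp add: X_def)
  also have "\<dots> \<le> real (3 * card missing)"
    unfolding mdeg_def of_nat_sum[symmetric] of_nat_le_iff
    using missing_edge fin by (intro sum_degrees_le finite_missing) (auto simp: X_def)
  also have "\<dots> \<le> 3 * (\<mu>\<^sup>2 / 192 * n ^ 3)" using missing_le by simp
  also have "\<dots> = \<mu> / 4 * n * (\<mu> / 16 * n\<^sup>2)" by (simp add: power2_eq_square power3_eq_cube)
  finally have "card X * (\<mu> / 16 * n\<^sup>2) \<le> \<mu> / 4 * n * (\<mu> / 16 * n\<^sup>2)" .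
  moreover have "0 < \<mu> / 16 * n\<^sup>2" using \<mu> n_pos by simp
  ultimately show ?thesis unfolding X_def by (rule mult_right_le_imp_le)
qed

lemma copy_if_bad:
  assumes v: "v \<in> V" "v \<notin> W" and W: "W \<subseteq> V" "card W \<le> K" and bad: "\<mu> * n\<^sup>2 \<le> bdeg v"
  shows "\<exists>U\<subseteq>V - W. is_copy (F5S m) E U"
proof -
  define X where "X = {x \<in> V. \<mu> / 16 * n\<^sup>2 \<le> mdeg x}"
  \<comment> \<open>The vertex \<open>v\<close> is kept out of \<open>Z\<close> because it may
    itself be atypical; all other vertices of the edges in \<open>G\<close> are typical.\<close>
  define Z where "Z = (W \<union> X) - {v}"
  define G where "G = {e \<in> E. v \<in> e \<and> \<not> inj_on c e \<and> e \<inter> Z = {}}"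
  have finG: "finite G" using finite_edges by (simp add: G_def)
  have finZ: "finite Z" using W fin by (auto simp: Z_def X_def intro: finite_subset)
  have "card Z \<le> card (W \<union> X)" using W fin by (intro card_mono) (auto simp: Z_def X_def intro: finite_subset)
  also have "\<dots> \<le> card W + card X" by (rule card_Un_le)
  finally have "real (card Z) \<le> \<mu> / 4 * n + \<mu> / 4 * n"
    using W(2) K_le card_atypical_le unfolding X_def by linarith
  then have Z: "real (card Z) \<le> \<mu> / 2 * n" by simp
  have "{e \<in> E. v \<in> e \<and> \<not> inj_on c e} \<subseteq> G \<union> {e \<in> E. v \<in> e \<and> e \<inter> Z \<noteq> {}}" by (auto simp: G_def)
  then have "bdeg v \<le> card (G \<union> {e \<in> E. v \<in> e \<and> e \<inter> Z \<noteq> {}})"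
    unfolding bdeg_def using finG finite_edges by (intro card_mono) auto
  also have "\<dots> \<le> card G + card {e \<in> E. v \<in> e \<and> e \<inter> Z \<noteq> {}}" by (rule card_Un_le)
  also have "card {e \<in> E. v \<in> e \<and> e \<inter> Z \<noteq> {}} \<le> card Z * card V"
    using edge fin finZ by (intro card_edges_through_vertex_meeting) (auto simp: Z_def)
  finally have "real (bdeg v) \<le> card G + real (card Z) * n" by (simp add: n_def flip: of_nat_mult of_nat_add)
  moreover have "real (card Z) * n \<le> \<mu> / 2 * n * n" using Z n_pos by (intro mult_right_mono) auto
  ultimately have G: "\<mu> / 2 * n\<^sup>2 \<le> card G" using bad by (simp add: power2_eq_square)
  have avoid: "y \<notin> W" "y \<in> V" "mdeg y < \<mu> / 16 * n\<^sup>2" if "e \<in> G" "y \<in> e" "y \<noteq> v" for e y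
    using that edge[of e] by (auto simp: G_def Z_def X_def)
  show ?thesis
  proof (cases "\<exists>x x'. {x, x', v} \<in> G \<and> x \<noteq> v \<and> x' \<noteq> v \<and> c x = c x'")
    case True
    then obtain x x' where x: "{x, x', v} \<in> G" "x \<noteq> v" "x' \<noteq> v" "c x = c x'" by blast
    have xV: "x \<in> V" "x \<notin> W" "x' \<in> V" "x' \<notin> W" and md: "mdeg x < \<mu> / 16 * n\<^sup>2" "mdeg x' < \<mu> / 16 * n\<^sup>2"
      using avoid[OF x(1)] x by auto
    \<comment> \<open>Both same-coloured vertices are typical, so \<open>x\<close> has almost its
      full transversal degree and exceeds the small missing degree of \<open>x'\<close>.\<close>
    obtain j k where jk: "j < 3" "k < 3" "c x \<noteq> j" "c x \<noteq> k" "j \<noteq> k" using other_colours[OF c3[of x]] by metis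
    have "n\<^sup>2 / 28 \<le> real (tdeg x + mdeg x)"
      unfolding tdeg_mdeg[OF xV(1) jk] using cls_pair_lower[of j k] jk by simp
    moreover have "\<mu> * n\<^sup>2 \<le> 1 / 672 * n\<^sup>2" using \<mu> by (intro mult_right_mono) auto
    ultimately have "mdeg x' + \<mu> / 8 * n\<^sup>2 \<le> tdeg x" using md by simp
    then show ?thesis
      using copy_if_degree[of x x' v W] x xV v W by (auto simp: G_def)
  next
    \<comment> \<open>Now every edge of \<open>G\<close> has a second vertex in the class of
      \<open>v\<close> and a third one elsewhere; by pigeonhole one other class \<open>l\<close>
      receives half of these edges.\<close>
    case False
    have shape: "\<exists>x y. e = {v, x, y} \<and> x \<noteq> v \<and> y \<noteq> v \<and> c x = c v \<and> c y \<noteq> c v" if "e \<in> G" for e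
    proof -
      have e: "card e = 3" "v \<in> e" "\<not> inj_on c e" using that edge by (auto simp: G_def)
      then have "card (e - {v}) = 2" by simp
      then obtain x y where xy: "e - {v} = {x, y}" "x \<noteq> y" by (auto simp: card_2_iff)
      then have e_eq: "e = {v, x, y}" "x \<noteq> v" "y \<noteq> v" using e by auto
      have "c x \<noteq> c y"
        using False that e_eq by (metis insert_commute)
      then have "c x = c v \<or> c y = c v" using e(3) e_eq(1) by (auto simp: inj_on_def)
      then show ?thesis
      proof
        assume "c x = c v"
        then show ?thesis using e_eq \<open>c x \<noteq> c y\<close> by (intro exI[of _ x] exI[of _ y]) auto
      next
        assume "c y = c v"
        then show ?thesis using e_eq \<open>c x \<noteq> c y\<close> by (intro exI[of _ y] exI[of _ x]) auto
      qed
    qed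
    obtain j k where jk: "j < 3" "k < 3" "c v \<noteq> j" "c v \<noteq> k" "j \<noteq> k" using other_colours[OF c3[of v]] by metis
    define H where "H l = {e \<in> G. \<exists>y\<in>e. c y = l}" for l
    have "G \<subseteq> H j \<union> H k"
    proof
      fix e assume "e \<in> G"
      then obtain x y where "e = {v, x, y}" "c y \<noteq> c v" using shape by blast
      moreover have "c y = j \<or> c y = k" using third_colour[of "c v" j k "c y"] c3 jk calculation by auto
      ultimately show "e \<in> H j \<union> H k" using \<open>e \<in> G\<close> by (auto simp: H_def)
    qed
    then have "card G \<le> card (H j \<union> H k)" using finG by (intro card_mono) (auto simp: H_def)
    also have "\<dots> \<le> card (H j) + card (H k)" by (rule card_Un_le)
    finally have "\<mu> / 4 * n\<^sup>2 \<le> card (H j) \<or> \<mu> / 4 * n\<^sup>2 \<le> card (H k)" using G by linarith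
    then obtain l r where lr: "l < 3" "r < 3" "c v \<noteq> l" "c v \<noteq> r" "l \<noteq> r" and Hl: "\<mu> / 4 * n\<^sup>2 \<le> card (H l)"
      using jk by metis
    \<comment> \<open>Moving \<open>v\<close> to the third class \<open>r\<close> would make every edge of \<open>H l\<close> transversal.\<close>
    define c' where "c' = c(v := r)"
    have "card {e \<in> E. inj_on c' e} \<le> card {e \<in> E. inj_on c e}"
      by (rule best) (use c3 lr in \<open>auto simp: c'_def\<close>)
    moreover have "card {e \<in> E. inj_on f e} = card {e \<in> E. v \<notin> e \<and> inj_on f e} + card {e \<in> E. v \<in> e \<and> inj_on f e}"
      for f :: "'a \<Rightarrow> nat"
      using finite_edges by (subst card_Un_disjoint[symmetric]) (auto intro!: arg_cong[where f = card])
    moreover have "{e \<in> E. v \<notin> e \<and> inj_on c' e} = {e \<in> E. v \<notin> e \<and> inj_on c e}"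
      by (auto simp: c'_def inj_on_def)
    ultimately have "card {e \<in> E. v \<in> e \<and> inj_on c' e} \<le> tdeg v" by (simp add: tdeg_def)
    moreover have "card (H l) \<le> card {e \<in> E. v \<in> e \<and> inj_on c' e}"
    proof (intro card_mono subsetI)
      fix e assume e: "e \<in> H l"
      then obtain x y where xy: "e = {v, x, y}" "x \<noteq> v" "y \<noteq> v" "c x = c v" "c y \<noteq> c v"
        using shape[of e] unfolding H_def by blast
      then have "c y = l" using e lr by (auto simp: H_def)
      then have "inj_on c' e" using xy lr by (auto simp: c'_def inj_on_def)
      then show "e \<in> {e \<in> E. v \<in> e \<and> inj_on c' e}" using e by (auto simp: H_def G_def)
    qed (use finite_edges in auto)
    \<comment> \<open>Since the colouring is best, the transversal degree of \<open>v\<close> is at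
      least what it would gain by moving. With a typical \<open>x\<close> of its own class this
      meets the hypothesis of \<open>copy_if_degree\<close>.\<close>
    ultimately have tv: "\<mu> / 4 * n\<^sup>2 \<le> tdeg v" using Hl by linarith
    have "0 < \<mu> / 4 * n\<^sup>2" using \<mu> n_pos by simp
    then have "H l \<noteq> {}" using Hl by auto
    then obtain e where "e \<in> G" by (auto simp: H_def)
    then obtain x y where xy: "e = {v, x, y}" "x \<noteq> v" "y \<noteq> v" "c x = c v" using shape by blast
    have "mdeg x < \<mu> / 16 * n\<^sup>2" using avoid[OF \<open>e \<in> G\<close>] xy by auto
    then have "mdeg x + \<mu> / 8 * n\<^sup>2 \<le> tdeg v" using tv \<mu> n_pos by simp
    then show ?thesis
      using copy_if_degree[of v x y W] xy avoid[OF \<open>e \<in> G\<close>] \<open>e \<in> G\<close> v W by (auto simp: G_def)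
  qed
qed

text \<open>Bad edges are charged to vertices of large missing degree, each of which carries fewer
  bad edges than a third of its missing triples. \<open>T\<close> is separate from \<open>W\<close>
  because the packing vertices are to stay in the final tripartite count, while the heavy ones leave
  it.\<close>

lemma bad_le_missing:
  assumes W: "W \<subseteq> V" "card W \<le> K" and free: "\<not> (\<exists>U\<subseteq>V - W. is_copy (F5S m) E U)"
    and small: "\<And>v. v \<in> V - W \<Longrightarrow> bdeg v < \<mu> * n\<^sup>2" and T: "T \<subseteq> W"
  shows "card {e \<in> E. e \<inter> W = {} \<and> \<not> inj_on c e} \<le> card {e \<in> missing. e \<inter> T = {}}"
proof -
  \<comment> \<open>For same-coloured \<open>x\<close>, \<open>x'\<close> on a bad edge, absence of
    a copy forces \<open>mdeg x + mdeg x'\<close> to be at least n^2 / 56; the larger of the two is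
    at least half of that.\<close>
  define Y where "Y = {x \<in> V - W. n\<^sup>2 / 112 \<le> mdeg x}"
  define B where "B = {e \<in> E. e \<inter> W = {} \<and> \<not> inj_on c e}"
  define M where "M = {e \<in> missing. e \<inter> T = {}}"
  have finY: "finite Y" using fin by (simp add: Y_def)
  have finM: "finite M" using finite_missing by (simp add: M_def)
  have "\<exists>x\<in>Y. x \<in> e" if "e \<in> B" for e
  proof -
    have e: "e \<in> E" "e \<inter> W = {}" "\<not> inj_on c e" "card e = 3" "e \<subseteq> V" using that edge by (auto simp: B_def)
    then obtain x x' where x: "x \<in> e" "x' \<in> e" "x \<noteq> x'" "c x = c x'" by (auto simp: inj_on_def)
    have "card (e - {x, x'}) = 1" using e x by (subst card_Diff_subset) auto
    then obtain z where "e - {x, x'} = {z}" by (auto simp: card_1_singleton_iff)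
    then have ez: "e = {x, x', z}" using x by auto
    have "tdeg x < mdeg x' + \<mu> / 8 * n\<^sup>2"
      using copy_if_degree[of x x' z W] free e ez W x by force
    moreover obtain j k where jk: "j < 3" "k < 3" "c x \<noteq> j" "c x \<noteq> k" "j \<noteq> k"
      using other_colours[OF c3[of x]] by metis
    have "n\<^sup>2 / 28 \<le> real (tdeg x + mdeg x)"
    proof -
      have "x \<in> V" using e x by auto
      then show ?thesis unfolding tdeg_mdeg[OF \<open>x \<in> V\<close> jk] using cls_pair_lower[of j k] jk by simp
    qed
    moreover have "\<mu> * n\<^sup>2 \<le> 1 / 672 * n\<^sup>2" using \<mu> by (intro mult_right_mono) auto
    ultimately have "n\<^sup>2 / 56 \<le> real (mdeg x) + mdeg x'" by simp
    then have "n\<^sup>2 / 112 \<le> mdeg x \<or> n\<^sup>2 / 112 \<le> mdeg x'" by linarith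
    then show ?thesis using x e by (auto simp: Y_def)
  qed
  then have "B \<subseteq> (\<Union>x\<in>Y. {e \<in> E. x \<in> e \<and> \<not> inj_on c e})" by (auto simp: B_def)
  then have "card B \<le> card (\<Union>x\<in>Y. {e \<in> E. x \<in> e \<and> \<not> inj_on c e})"
    using finY finite_edges by (intro card_mono) auto
  also have "\<dots> \<le> (\<Sum>x\<in>Y. bdeg x)" unfolding bdeg_def by (rule card_UN_le[OF finY])
  finally have "real (card B) \<le> (\<Sum>x\<in>Y. real (bdeg x))" by (simp flip: of_nat_sum)
  also have "\<dots> \<le> (\<Sum>x\<in>Y. \<mu> * n\<^sup>2)" using small by (intro sum_mono less_imp_le) (auto simp: Y_def)
  \<comment> \<open>The factor 1/3 pays for counting a missing triple at up to three vertices. Here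
    3 \<open>\<mu>\<close> is at most half of 1/112, and the other half covers the triples meeting
    \<open>T\<close>.\<close>
  also have "\<dots> \<le> (\<Sum>x\<in>Y. real (card {e \<in> M. x \<in> e}) / 3)"
  proof (rule sum_mono)
    fix x assume "x \<in> Y"
    then have x: "n\<^sup>2 / 112 \<le> mdeg x" "x \<notin> T" using T by (auto simp: Y_def)
    have finT: "finite T" using T W fin by (meson finite_subset)
    have "{e \<in> missing. x \<in> e} \<subseteq> {e \<in> M. x \<in> e} \<union> {e \<in> missing. x \<in> e \<and> e \<inter> T \<noteq> {}}"
      by (auto simp: M_def)
    then have "mdeg x \<le> card ({e \<in> M. x \<in> e} \<union> {e \<in> missing. x \<in> e \<and> e \<inter> T \<noteq> {}})"
      unfolding mdeg_def using finM finite_missing by (intro card_mono) auto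
    also have "\<dots> \<le> card {e \<in> M. x \<in> e} + card {e \<in> missing. x \<in> e \<and> e \<inter> T \<noteq> {}}" by (rule card_Un_le)
    also have "card {e \<in> missing. x \<in> e \<and> e \<inter> T \<noteq> {}} \<le> card T * card V"
      using missing_edge x finT by (intro card_edges_through_vertex_meeting[OF fin]) auto
    also have "card T * card V \<le> K * card V"
      using W T fin by (intro mult_right_mono order_trans[OF card_mono W(2)]) (auto intro: finite_subset)
    finally have "real (mdeg x) \<le> card {e \<in> M. x \<in> e} + K * n"
      by (simp add: n_def flip: of_nat_mult of_nat_add)
    moreover have "4 * (K * n) \<le> 1 / 672 * n\<^sup>2"
    proof -
      have "4 * real K * n \<le> \<mu> * n * n" using K_le n_pos by (intro mult_right_mono) auto
      also have "\<dots> \<le> 1 / 672 * n * n" using \<mu> n_pos by (intro mult_right_mono) auto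
      finally show ?thesis by (simp add: power2_eq_square)
    qed
    moreover have "\<mu> * n\<^sup>2 \<le> 1 / 672 * n\<^sup>2" using \<mu> by (intro mult_right_mono) auto
    ultimately show "\<mu> * n\<^sup>2 \<le> real (card {e \<in> M. x \<in> e}) / 3" using x(1) by simp
  qed
  also have "\<dots> = real (\<Sum>x\<in>Y. card {e \<in> M. x \<in> e}) / 3" by (simp add: sum_divide_distrib)
  also have "\<dots> \<le> real (3 * card M) / 3"
    using missing_edge by (intro divide_right_mono of_nat_mono sum_degrees_le finM finY) (auto simp: M_def)
  finally show ?thesis by (simp add: B_def M_def)
qed

end

section \<open>Packings of disjoint copies\<close>

lemma packing_extend:
  assumes "packing F E p U" "\<forall>i<p. U i \<subseteq> V" "is_copy F E P"
    "P \<subseteq> V - \<Union> (U ` {..<p})"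
  shows "packing F E (Suc p) (U(p := P)) \<and> (\<forall>i<Suc p. (U(p := P)) i \<subseteq> V)"
proof -
  have "U i \<inter> P = {}" if "i < p" for i using assms(4) that by auto
  then show ?thesis using assms(1-3) assms(4) unfolding packing_def
    by (auto simp: less_Suc_eq)
qed

text \<open>Take the least \<open>p\<close> such that \<open>p + 1\<close> disjoint copies do not
  exist: then \<open>p\<close> copies do exist and no further one fits beside them.\<close>

lemma maximal_packing:
  assumes "\<not> (\<exists>U. packing F E (Suc b) U \<and> (\<forall>i<Suc b. U i \<subseteq> V))"
  obtains p U where "p \<le> b" "packing F E p U" "\<And>i. i < p \<Longrightarrow> U i \<subseteq> V"
    "\<not> (\<exists>P\<subseteq>V - \<Union> (U ` {..<p}). is_copy F E P)"
proof -
  define has where "has p \<longleftrightarrow> (\<exists>U. packing F E p U \<and> (\<forall>i<p. U i \<subseteq> V))" for p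
  define p where "p = (LEAST p. \<not> has (Suc p))"
  have nb: "\<not> has (Suc b)" using assms by (simp add: has_def)
  then have "\<not> has (Suc p)" unfolding p_def by (rule LeastI[of "\<lambda>p. \<not> has (Suc p)"])
  moreover have "has p"
  proof (cases p)
    case 0
    then show ?thesis by (simp add: has_def packing_def)
  next
    case (Suc q)
    then show ?thesis using not_less_Least[of q "\<lambda>p. \<not> has (Suc p)"] by (simp add: p_def)
  qed
  then obtain U where U: "packing F E p U" "\<forall>i<p. U i \<subseteq> V" by (auto simp: has_def)
  ultimately have "\<not> is_copy F E P" if "P \<subseteq> V - \<Union> (U ` {..<p})" for P
    using packing_extend[OF U _ that] unfolding has_def by metis
  then have "\<not> (\<exists>P\<subseteq>V - \<Union> (U ` {..<p}). is_copy F E P)" by metis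
  moreover have "p \<le> b" unfolding p_def using nb by (rule Least_le)
  ultimately show ?thesis using that[of p U] U by metis
qed

lemma card_packing_union:
  assumes "packing (F5S m) E p U"
  shows "card (\<Union> (U ` {..<p})) \<le> p * (3 * m + 1)"
proof -
  have "card (\<Union> (U ` {..<p})) \<le> (\<Sum>i<p. card (U i))" by (rule card_UN_le) simp
  also have "\<dots> = (\<Sum>i<p. 3 * m + 1)"
    using assms by (intro sum.cong refl card_copy_F5S) (auto simp: packing_def)
  finally show ?thesis by simp
qed

section \<open>Sizes of balanced tripartite graphs\<close>

lemma balanced_product:
  fixes a b p q :: nat
  assumes "a + b \<le> p + q" "p \<le> q + 1" "q \<le> p + 1"
  shows "a * b \<le> p * q"
proof -
  have main: "a * b \<le> p * q" if "a \<le> b" "p \<le> q" "a + b \<le> p + q" "q \<le> p + 1" for a b p q :: nat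
  proof -
    have "a \<le> p" using that by linarith
    then obtain d where d: "p = a + d" using le_iff_add by blast
    then have "b \<le> q + d" using that by linarith
    then have "a * b \<le> a * (q + d)" by simp
    also have "a * d \<le> d * q" using that d by (simp add: mult.commute)
    then have "a * (q + d) \<le> p * q" by (simp add: d algebra_simps)
    finally show ?thesis .
  qed
  show ?thesis
    using main[of a b p q] main[of b a p q] main[of a b q p] main[of b a q p] assms
    by (metis add.commute mult.commute nle_le)
qed

text \<open>The factors are the sizes of the residue classes 0, 1, 2 from \<open>card_part\<close>,
  hence in decreasing order.\<close>

definition turan_size :: "nat \<Rightarrow> nat" where
  "turan_size N = ((N + 2) div 3) * ((N + 1) div 3) * (N div 3)"

text \<open>The new vertex joins the smallest class and spans an edge with each pair from the other
  two.\<close>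

lemma turan_size_Suc: "turan_size (Suc N) = turan_size N + ((N + 2) div 3) * ((N + 1) div 3)"
proof -
  have "(Suc N + 2) div 3 = N div 3 + 1" by simp
  then show ?thesis by (simp add: turan_size_def algebra_simps)
qed

lemma sum_div_3: "(N + 2) div 3 + (N + 1) div 3 + N div 3 = (N :: nat)"
  by (induction N) simp_all

text \<open>Induction removes a vertex of the largest class. That class has more than
  \<open>N div 3\<close> elements, so the product of the other two is at most the balanced
  one.\<close>

lemma product_le_turan_size: "a + b + c = N \<Longrightarrow> a * b * c \<le> turan_size N"
proof (induction N arbitrary: a b c)
  case (Suc N)
  have main: "a * b * c \<le> turan_size (Suc N)" if abc: "a + b + c = Suc N" "b \<le> a" "c \<le> a" for a b c
  proof -
    obtain a' where a: "a = Suc a'" using abc by (cases a) auto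
    then have "a' * b * c \<le> turan_size N" using abc by (intro Suc.IH) simp
    moreover have "b * c \<le> ((N + 2) div 3) * ((N + 1) div 3)"
    proof (rule balanced_product)
      have "3 * (N div 3) \<le> N" by simp
      then show "b + c \<le> (N + 2) div 3 + (N + 1) div 3" using abc sum_div_3[of N] by linarith
      show "(N + 2) div 3 \<le> (N + 1) div 3 + 1" using div_le_mono[of "N + 2" "N + 4" 3] by simp
      show "(N + 1) div 3 \<le> (N + 2) div 3 + 1" using div_le_mono[of "N + 1" "N + 2" 3] by simp
    qed
    moreover have "a * b * c = a' * b * c + b * c" by (simp add: a algebra_simps)
    ultimately show ?thesis unfolding turan_size_Suc by linarith
  qed
  consider "b \<le> a" "c \<le> a" | "a \<le> b" "c \<le> b" | "a \<le> c" "b \<le> c" by linarith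
  then show ?case
  proof cases
    case 1 then show ?thesis using main Suc.prems by blast
  next
    case 2 then show ?thesis using main[of b a c] Suc.prems by (simp add: mult_ac add_ac)
  next
    case 3 then show ?thesis using main[of c a b] Suc.prems by (simp add: mult_ac add_ac)
  qed
qed simp

lemma turan_size_lower:
  assumes "2 \<le> N"
  shows "(real N - 2) ^ 3 / 27 \<le> turan_size N"
proof -
  have "N \<le> 3 * ((N + 2) div 3) + 2" "N \<le> 3 * ((N + 1) div 3) + 2" "N \<le> 3 * (N div 3) + 2"
    by linarith+
  then have "real N \<le> real (3 * ((N + 2) div 3) + 2)" "real N \<le> real (3 * ((N + 1) div 3) + 2)"
    "real N \<le> real (3 * (N div 3) + 2)" by (simp_all only: of_nat_le_iff)
  then have "(real N - 2) / 3 \<le> real ((N + 2) div 3)" "(real N - 2) / 3 \<le> real ((N + 1) div 3)"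
    "(real N - 2) / 3 \<le> real (N div 3)" by (simp_all add: field_simps)
  then have "(real N - 2) / 3 * ((real N - 2) / 3) * ((real N - 2) / 3) \<le> real (turan_size N)"
    unfolding turan_size_def of_nat_mult using assms by (intro mult_mono) auto
  then show ?thesis by (simp add: power3_eq_cube)
qed

text \<open>By \<open>card_extremal_graph\<close>, the deficit at \<open>n - t\<close> counts the
  triples absent from the extremal graph. One more vertex adds about (1/2 - 1/9) N^2 to it, and the
  weaker N^2 / 4 holds from N = 8 on.\<close>

lemma turan_deficit_Suc:
  assumes "8 \<le> N"
  shows "real (N choose 3) - turan_size N + (real N)\<^sup>2 / 4 \<le> real (Suc N choose 3) - turan_size (Suc N)"
proof -
  have "Suc N choose 3 = (N choose 2) + (N choose 3)" by (simp add: numeral_3_eq_3 numeral_2_eq_2)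
  moreover have "real (N choose 2) = real N * (real N - 1) / 2"
    using assms by (simp add: choose_two real_of_nat_div of_nat_diff)
  moreover have "real ((N + 2) div 3) * real ((N + 1) div 3) \<le> (real N + 2) / 3 * ((real N + 2) / 3)"
  proof -
    have "3 * ((N + 2) div 3) \<le> N + 2" "3 * ((N + 1) div 3) \<le> N + 2" by linarith+
    then have "real (3 * ((N + 2) div 3)) \<le> real (N + 2)" "real (3 * ((N + 1) div 3)) \<le> real (N + 2)"
      by (simp_all only: of_nat_le_iff)
    then have "real ((N + 2) div 3) \<le> (real N + 2) / 3" "real ((N + 1) div 3) \<le> (real N + 2) / 3"
      by (simp_all add: field_simps)
    then show ?thesis by (intro mult_mono) auto
  qed
  moreover have "(real N)\<^sup>2 / 4 + (real N + 2) / 3 * ((real N + 2) / 3) \<le> real N * (real N - 1) / 2"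
  proof -
    have "8 * real N \<le> real N * real N" using assms by (intro mult_right_mono) auto
    moreover have "real N * (real N * 10) = 10 * (real N * real N)" "8 \<le> real N" using assms by simp_all
    ultimately have "32 + real N * 68 \<le> real N * (real N * 10)" by linarith
    then show ?thesis by (simp add: power2_eq_square field_simps)
  qed
  ultimately show ?thesis by (simp add: turan_size_Suc)
qed

text \<open>In terms of extremal graphs: passing from \<open>s\<close> to \<open>t\<close> special
  vertices gains at least n^2 / 16 edges per vertex, since all intermediate orders are at least n /
  2.\<close>

lemma turan_deficit_mono:
  assumes "s \<le> t" "t \<le> n" "8 \<le> n - t" "n \<le> 2 * (n - t)"
  shows "real (n - t choose 3) - turan_size (n - t) + real (t - s) * ((real n)\<^sup>2 / 16)
    \<le> real (n - s choose 3) - turan_size (n - s)"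
  using assms(1)
proof (induction "t - s" arbitrary: s)
  case (Suc d)
  then have st: "Suc s \<le> t" and d: "d = t - Suc s" by auto
  have IH: "real (n - t choose 3) - turan_size (n - t) + real (t - Suc s) * ((real n)\<^sup>2 / 16)
    \<le> real (n - Suc s choose 3) - turan_size (n - Suc s)"
    using Suc.hyps(1)[OF d st] .
  have eq: "Suc (n - Suc s) = n - s" using st assms by simp
  have "real (n - Suc s choose 3) - turan_size (n - Suc s) + (real (n - Suc s))\<^sup>2 / 4
    \<le> real (n - s choose 3) - turan_size (n - s)"
    using turan_deficit_Suc[of "n - Suc s"] assms st unfolding eq by simp
  moreover have "(real n)\<^sup>2 / 16 \<le> (real (n - Suc s))\<^sup>2 / 4"
  proof -
    have "real n / 2 \<le> real (n - Suc s)" using assms st by linarith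
    then have "(real n / 2)\<^sup>2 \<le> (real (n - Suc s))\<^sup>2" by (intro power_mono) auto
    then show ?thesis by (simp add: power_divide)
  qed
  moreover have "real (t - s) * ((real n)\<^sup>2 / 16) = real (t - Suc s) * ((real n)\<^sup>2 / 16) + (real n)\<^sup>2 / 16"
  proof -
    have "real (t - s) = real (t - Suc s) + 1" using st by (simp add: of_nat_diff)
    then show ?thesis by (simp only: distrib_right mult_1)
  qed
  ultimately show ?case using IH by linarith
qed simp

lemma card_triples_meeting:
  assumes "finite V" "T \<subseteq> V"
  shows "card {e. e \<subseteq> V \<and> card e = 3 \<and> e \<inter> T \<noteq> {}} + (card V - card T choose 3) = (card V choose 3)"
proof -
  have finT: "finite T" by (rule finite_subset[OF assms(2,1)])
  have fin: "finite {e. e \<subseteq> V \<and> card e = 3}" by (rule finite_subset[of _ "Pow V"]) (auto simp: assms(1))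
  have "{e. e \<subseteq> V \<and> card e = 3} = {e. e \<subseteq> V \<and> card e = 3 \<and> e \<inter> T \<noteq> {}} \<union> {e. e \<subseteq> V - T \<and> card e = 3}"
    by blast
  then have "card {e. e \<subseteq> V \<and> card e = 3} =
      card ({e. e \<subseteq> V \<and> card e = 3 \<and> e \<inter> T \<noteq> {}} \<union> {e. e \<subseteq> V - T \<and> card e = 3})" by simp
  also have "\<dots> = card {e. e \<subseteq> V \<and> card e = 3 \<and> e \<inter> T \<noteq> {}} + card {e. e \<subseteq> V - T \<and> card e = 3}"
    by (intro card_Un_disjoint finite_subset[OF _ fin]) auto
  finally show ?thesis
    using n_subsets[of V 3] n_subsets[of "V - T" 3] assms finT by (simp add: card_Diff_subset)
qed

section \<open>Counting edges around the heavy vertices\<close>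

context near_extremal
begin

definition heavy :: "'a set" where
  "heavy = {v \<in> V. \<mu> * n\<^sup>2 \<le> bdeg v}"

text \<open>Each heavy vertex provides one more copy. The heavy vertices still to be treated are
  forbidden along with the copies already chosen, so they remain available; \<open>3 * m + 2\<close>
  per step allows for a copy and one reserved vertex.\<close>

lemma greedy_packing:
  assumes "finite T" "T \<subseteq> heavy" "packing (F5S m) E p U" "\<And>i. i < p \<Longrightarrow> U i \<subseteq> V - T"
    and "p + card T \<le> k" "k * (3 * m + 2) \<le> K"
  shows "\<exists>U. packing (F5S m) E (p + card T) U \<and> (\<forall>i<p + card T. U i \<subseteq> V)"
  using assms(1-5)
proof (induction T arbitrary: p U rule: finite_induct)
  case empty
  then show ?case by auto
next
  case (insert v T)
  define W where "W = \<Union> (U ` {..<p}) \<union> T"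
  have W: "W \<subseteq> V" "v \<notin> W" using insert.prems insert.hyps by (auto simp: W_def heavy_def)
  have "card W \<le> p * (3 * m + 1) + card T"
    unfolding W_def using card_packing_union[OF insert.prems(2)] by (meson card_Un_le add_le_mono1 order_trans)
  also have "\<dots> \<le> (p + card (insert v T)) * (3 * m + 2)" using insert.hyps by (simp add: algebra_simps)
  also have "\<dots> \<le> K" using insert.prems(4) assms(6) by (meson mult_le_mono1 order_trans)
  finally have cW: "card W \<le> K" .
  have "v \<in> V" "\<mu> * n\<^sup>2 \<le> bdeg v" using insert.prems(1) by (auto simp: heavy_def)
  then obtain P where P: "P \<subseteq> V - W" "is_copy (F5S m) E P"
    using copy_if_bad[OF _ W(2,1) cW] by blast
  have Ui: "\<forall>i<p. U i \<subseteq> V - T" using insert.prems(3) by blast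
  have "P \<subseteq> (V - T) - \<Union> (U ` {..<p})" using P by (auto simp: W_def)
  then obtain U' where U': "packing (F5S m) E (Suc p) U'" "\<forall>i<Suc p. U' i \<subseteq> V - T"
    using packing_extend[OF insert.prems(2) Ui P(2)] by blast
  have "p + card (insert v T) = Suc p + card T" using insert.hyps by simp
  then show ?case using insert.IH[of "Suc p" U'] insert.prems(1,4) U' by auto
qed

text \<open>The conclusion says that \<open>E\<close> exceeds the extremal graph with
  \<open>s\<close> special vertices by at most an error linear in \<open>t - s\<close>, which
  vanishes for \<open>s = t\<close>.\<close>

lemma edge_bound:
  assumes free: "\<not> (\<exists>U. packing (F5S m) E (t + 1) U \<and> (\<forall>i<t + 1. U i \<subseteq> V))"
    and K: "(t + 1) * (3 * m + 2) \<le> K"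
  obtains s where "s \<le> t" "real (card E) + (card V - s choose 3) \<le>
    real (card V choose 3) + turan_size (card V - s) + real (t - s) * ((3 * m + 1) * \<mu> * n\<^sup>2)"
proof -
  have finT: "finite heavy" using fin by (simp add: heavy_def)
  have TV: "heavy \<subseteq> V" by (auto simp: heavy_def)
  define s where "s = card heavy"
  have st: "s \<le> t"
  proof (rule ccontr)
    assume "\<not> s \<le> t"
    then have "t + 1 \<le> card heavy" by (simp add: s_def)
    then obtain T where T: "T \<subseteq> heavy" "card T = t + 1"
      by (elim obtain_subset_with_card_n)
    have "packing (F5S m) E 0 (\<lambda>_. {})" by (simp add: packing_def)
    then show False
      using greedy_packing[OF finite_subset[OF T(1) finT] T(1), of 0 "\<lambda>_. {}" "t + 1"] free K T(2) by auto
  qed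
  \<comment> \<open>One copy more than \<open>t - s\<close> away from the heavy vertices would
    combine with \<open>s\<close> greedy copies to the forbidden \<open>t + 1\<close>.\<close>
  have "\<not> (\<exists>U. packing (F5S m) E (Suc (t - s)) U \<and> (\<forall>i<Suc (t - s). U i \<subseteq> V - heavy))"
  proof
    assume "\<exists>U. packing (F5S m) E (Suc (t - s)) U \<and> (\<forall>i<Suc (t - s). U i \<subseteq> V - heavy)"
    then obtain U where "packing (F5S m) E (Suc (t - s)) U" "\<And>i. i < Suc (t - s) \<Longrightarrow> U i \<subseteq> V - heavy"
      by blast
    moreover have eq: "Suc (t - s) + card heavy = t + 1" using st by (simp add: s_def)
    ultimately have "\<exists>U. packing (F5S m) E (Suc (t - s) + card heavy) U \<and>
        (\<forall>i<Suc (t - s) + card heavy. U i \<subseteq> V)"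
      using K by (intro greedy_packing[where k = "t + 1"] finT) auto
    then show False using free unfolding eq by contradiction
  qed
  then obtain p U where p: "p \<le> t - s" and U: "packing (F5S m) E p U"
    and UV: "\<And>i. i < p \<Longrightarrow> U i \<subseteq> V - heavy"
    and max: "\<not> (\<exists>P\<subseteq>V - heavy - \<Union> (U ` {..<p}). is_copy (F5S m) E P)"
    using maximal_packing by metis
  define X where "X = \<Union> (U ` {..<p})"
  define W where "W = heavy \<union> X"
  have X: "X \<subseteq> V - heavy" "card X \<le> p * (3 * m + 1)"
    using UV card_packing_union[OF U] by (auto simp: X_def)
  have finX: "finite X" using X fin by (meson finite_Diff finite_subset)
  have W: "W \<subseteq> V" using X TV by (auto simp: W_def)
  have "card W \<le> s + p * (3 * m + 1)" unfolding W_def s_def using X(2) by (meson card_Un_le add_le_mono order_refl order_trans)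
  also have "\<dots> \<le> s + (t - s) * (3 * m + 1)" by (intro add_left_mono mult_le_mono1 p)
  also have "\<dots> \<le> (t + 1) * (3 * m + 2)"
  proof -
    have "s + (t - s) * (3 * m + 1) \<le> s * (3 * m + 1) + (t - s) * (3 * m + 1)" by simp
    also have "\<dots> = t * (3 * m + 1)" using st by (simp flip: add_mult_distrib)
    also have "\<dots> \<le> (t + 1) * (3 * m + 2)" by (intro mult_le_mono) auto
    finally show ?thesis .
  qed
  finally have cW: "card W \<le> K" using K by linarith
  have VW: "V - heavy - X = V - W" by (auto simp: W_def)
  have B: "card {e \<in> E. e \<inter> W = {} \<and> \<not> inj_on c e} \<le> card {e \<in> missing. e \<inter> heavy = {}}"
  proof (rule bad_le_missing[OF W cW])
    show "\<not> (\<exists>P\<subseteq>V - W. is_copy (F5S m) E P)" using max unfolding X_def[symmetric] VW .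
    show "bdeg v < \<mu> * n\<^sup>2" if "v \<in> V - W" for v
      using that by (auto simp: W_def heavy_def)
    show "heavy \<subseteq> W" by (simp add: W_def)
  qed
  \<comment> \<open>All triples meeting \<open>heavy\<close> are allowed for, whether or not they
    are edges. Away from \<open>heavy\<close>, transversal edges are never split by the packing;
    only non-transversal ones are, into \<open>A3\<close> and \<open>A4\<close>.\<close>
  define A1 where "A1 = {e. e \<subseteq> V \<and> card e = 3 \<and> e \<inter> heavy \<noteq> {}}"
  define A2 where "A2 = {e \<in> E. inj_on c e \<and> e \<inter> heavy = {}}"
  define A3 where "A3 = {e \<in> E. \<not> inj_on c e \<and> e \<inter> X \<noteq> {}}"
  define A4 where "A4 = {e \<in> E. e \<inter> W = {} \<and> \<not> inj_on c e}"
  have "E \<subseteq> A1 \<union> (A2 \<union> (A3 \<union> A4))" using edge by (auto simp: A1_def A2_def A3_def A4_def W_def)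
  moreover have "finite (A1 \<union> (A2 \<union> (A3 \<union> A4)))"
    using finite_edges fin by (auto simp: A1_def A2_def A3_def A4_def)
  ultimately have "card E \<le> card (A1 \<union> (A2 \<union> (A3 \<union> A4)))" by (rule card_mono[rotated])
  also have "\<dots> \<le> card A1 + (card A2 + (card A3 + card A4))"
    by (meson card_Un_le add_le_mono order_refl order_trans)
  finally have split: "real (card E) \<le> card A1 + (card A2 + (card A3 + card A4))" by linarith
  have A1: "card A1 + (card V - s choose 3) = card V choose 3"
    using card_triples_meeting[OF fin TV] by (simp add: A1_def s_def)
  have A24: "card A2 + card A4 \<le> turan_size (card V - s)"
  proof -
    \<comment> \<open>The missing triples avoiding \<open>heavy\<close> pay for \<open>A4\<close>;
      with \<open>A2\<close> they make up exactly the transversal triples of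
      \<open>V - heavy\<close>. The empty edge set serves only to reuse the counting of such
      triples.\<close>
    interpret T: coloured "V - heavy" "{}" c using fin c3 by unfold_locales auto
    have "card A2 + card {e \<in> missing. e \<inter> heavy = {}} = card (A2 \<union> {e \<in> missing. e \<inter> heavy = {}})"
      using finite_edges finite_missing
      by (intro card_Un_disjoint[symmetric]) (auto simp: A2_def missing_def)
    also have "A2 \<union> {e \<in> missing. e \<inter> heavy = {}} = T.rainbow"
      using edge by (auto simp: A2_def missing_def rainbow_def T.rainbow_def)
    also have "card T.rainbow \<le> turan_size (card (V - heavy))"
      using product_le_turan_size[OF T.card_classes] T.card_rainbow[of 0 1 2] by simp
    finally show ?thesis using B TV finT by (simp add: A4_def s_def card_Diff_subset)
  qed
  have "real (card A3) \<le> real (t - s) * ((3 * m + 1) * \<mu> * n\<^sup>2)"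
  proof -
    have "A3 = (\<Union>x\<in>X. {e \<in> E. x \<in> e \<and> \<not> inj_on c e})" by (auto simp: A3_def)
    then have "card A3 \<le> (\<Sum>x\<in>X. bdeg x)" unfolding bdeg_def using card_UN_le[OF finX] by simp
    then have "real (card A3) \<le> (\<Sum>x\<in>X. real (bdeg x))" by (simp flip: of_nat_sum)
    also have "\<dots> \<le> (\<Sum>x\<in>X. \<mu> * n\<^sup>2)" using X by (intro sum_mono) (auto simp: heavy_def)
    also have "\<dots> = card X * (\<mu> * n\<^sup>2)" by simp
    also have "\<dots> \<le> real ((t - s) * (3 * m + 1)) * (\<mu> * n\<^sup>2)"
    proof (rule mult_right_mono)
      have "p * (3 * m + 1) \<le> (t - s) * (3 * m + 1)" using p by (rule mult_le_mono1)
      then show "real (card X) \<le> real ((t - s) * (3 * m + 1))" using X(2) by linarith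
    qed (use \<mu> in simp)
    also have "real ((t - s) * (3 * m + 1)) * (\<mu> * n\<^sup>2) = real (t - s) * ((3 * m + 1) * \<mu> * n\<^sup>2)"
      by (simp only: of_nat_mult mult.assoc)
    finally show ?thesis .
  qed
  then have "real (card E) + (card V - s choose 3) \<le>
    real (card V choose 3) + turan_size (card V - s) + real (t - s) * ((3 * m + 1) * \<mu> * n\<^sup>2)"
    using split A1 A24 by linarith
  then show ?thesis using that st by blast
qed

end

section \<open>The extremal construction\<close>

lemma turan3_edges:
  shows "card (edges (turan3 N)) = turan_size N"
    and "e \<in> edges (turan3 N) \<Longrightarrow> inj_on (\<lambda>x. x mod 3) e \<and> e \<subseteq> {..<N} \<and> card e = 3"
proof -
  interpret coloured "{..<N}" "{}" "\<lambda>x. x mod 3" by unfold_locales auto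
  have cls: "cls i = part N i" for i by (auto simp: cls_def part_def)
  have img: "(\<lambda>p. {fst (fst p), snd (fst p), snd p}) ` ((A \<times> B) \<times> C) =
      {{x, y, z} | x y z. x \<in> A \<and> y \<in> B \<and> z \<in> C}" for A B C :: "nat set"
  proof (intro equalityI subsetI)
    fix e assume "e \<in> {{x, y, z} | x y z. x \<in> A \<and> y \<in> B \<and> z \<in> C}"
    then obtain x y z where "e = {x, y, z}" "x \<in> A" "y \<in> B" "z \<in> C" by blast
    then show "e \<in> (\<lambda>p. {fst (fst p), snd (fst p), snd p}) ` ((A \<times> B) \<times> C)"
      by (intro image_eqI[where x = "((x, y), z)"]) simp_all
  next
    fix e assume "e \<in> (\<lambda>p. {fst (fst p), snd (fst p), snd p}) ` ((A \<times> B) \<times> C)"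
    then obtain p where "p \<in> (A \<times> B) \<times> C" "e = {fst (fst p), snd (fst p), snd p}" by blast
    moreover then have "fst (fst p) \<in> A" "snd (fst p) \<in> B" "snd p \<in> C" by auto
    ultimately show "e \<in> {{x, y, z} | x y z. x \<in> A \<and> y \<in> B \<and> z \<in> C}" by blast
  qed
  have eq: "edges (turan3 N) = rainbow"
    using rainbow_bij[of 2 0 1] by (simp add: bij_betw_def turan3_def img cls)
  show "card (edges (turan3 N)) = turan_size N"
    unfolding eq using card_rainbow[of 0 1 2] by (simp add: cls card_part turan_size_def)
  show "e \<in> edges (turan3 N) \<Longrightarrow> inj_on (\<lambda>x. x mod 3) e \<and> e \<subseteq> {..<N} \<and> card e = 3"
    unfolding eq rainbow_def by simp
qed

lemma card_extremal_graph:
  assumes "t \<le> n"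
  shows "card (edges (extremal_graph t n)) + (n - t choose 3) = (n choose 3) + turan_size (n - t)"
proof -
  define A where "A = {e. e \<subseteq> {..<n} \<and> card e = 3 \<and> e \<inter> {n - t..<n} \<noteq> {}}"
  have "edges (extremal_graph t n) = edges (turan3 (n - t)) \<union> A"
    by (simp add: extremal_graph_def A_def)
  moreover have "edges (turan3 (n - t)) \<inter> A = {}" using turan3_edges(2) by (fastforce simp: A_def)
  moreover have "finite A" by (rule finite_subset[of _ "Pow {..<n}"]) (auto simp: A_def)
  moreover have "finite (edges (turan3 (n - t)))"
    by (rule finite_subset[of _ "Pow {..<n - t}"]) (use turan3_edges(2) in auto)
  ultimately have "card (edges (extremal_graph t n)) = turan_size (n - t) + card A"
    by (simp add: card_Un_disjoint turan3_edges(1))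
  moreover have "card A + (n - t choose 3) = n choose 3"
    using card_triples_meeting[of "{..<n}" "{n - t..<n}"] assms by (simp add: A_def subset_iff)
  ultimately show ?thesis by simp
qed

text \<open>The edges \<open>{0, 1, 2}\<close> and \<open>{3, 1, 2}\<close> force the images of 0
  and 3 into one class, yet both lie in the edge \<open>{3 * m, 0, 3}\<close>.\<close>

lemma turan3_copy_free:
  assumes "2 \<le> m"
  shows "\<not> is_copy (F5S m) (edges (turan3 N)) U"
proof
  assume "is_copy (F5S m) (edges (turan3 N)) U"
  then obtain f where inj: "inj_on f (verts (F5S m))"
    and e: "\<And>e. e \<in> edges (F5S m) \<Longrightarrow> f ` e \<in> edges (turan3 N)"
    unfolding is_copy_def by blast
  have col: "inj_on (\<lambda>x. f x mod 3) e" if "e \<in> edges (F5S m)" for e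
  proof -
    have "e \<subseteq> verts (F5S m)" using three_graph_F5S[OF assms] that by (simp add: three_graph_def)
    then have "inj_on f e" by (rule inj_on_subset[OF inj])
    then show ?thesis
      using comp_inj_on[of f e "\<lambda>x. x mod 3"] turan3_edges(2)[OF e[OF that]] by (simp add: comp_def)
  qed
  have "0 \<in> part (3 * m) 0" "3 \<in> part (3 * m) 0" "1 \<in> part (3 * m) 1" "2 \<in> part (3 * m) 2"
    using assms by (simp_all add: part_def)
  then have "{0, 1, 2} \<in> edges (F5S m)" "{3, 1, 2} \<in> edges (F5S m)" "{3 * m, 0, 3} \<in> edges (F5S m)"
    unfolding F5S_def turan3_def snd_conv by blast+
  note col[OF this(1)] col[OF this(2)] inj_on_subset[OF col[OF this(3)], of "{0, 3}"]
  then have "f 0 mod 3 \<noteq> f 1 mod 3" "f 0 mod 3 \<noteq> f 2 mod 3" "f 1 mod 3 \<noteq> f 2 mod 3"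
    "f 3 mod 3 \<noteq> f 1 mod 3" "f 3 mod 3 \<noteq> f 2 mod 3" "f 0 mod 3 \<noteq> f 3 mod 3"
    by (simp_all add: inj_on_def)
  then show False
    using third_colour[of "f 1 mod 3" "f 2 mod 3" "f 0 mod 3" "f 3 mod 3"] by simp
qed

text \<open>A copy avoiding the \<open>t\<close> special vertices would lie in the tripartite part,
  so disjoint copies use up distinct special vertices.\<close>

lemma extremal_graph_free:
  assumes "t \<le> n" "2 \<le> m"
  shows "\<not> contains_copy (extremal_graph t n) (disjoint_copies (t + 1) (F5S m))"
proof
  assume "contains_copy (extremal_graph t n) (disjoint_copies (t + 1) (F5S m))"
  then obtain U where U: "packing (F5S m) (edges (extremal_graph t n)) (t + 1) U"
    unfolding contains_disjoint_copies_iff by blast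
  have "U i \<inter> {n - t..<n} \<noteq> {}" if "i < t + 1" for i
  proof
    assume empty: "U i \<inter> {n - t..<n} = {}"
    have "is_copy (F5S m) (edges (extremal_graph t n)) (U i)" using U that by (simp add: packing_def)
    then obtain f where f: "inj_on f (verts (F5S m))" "f ` verts (F5S m) = U i"
      and e: "\<And>e. e \<in> edges (F5S m) \<Longrightarrow> f ` e \<in> edges (extremal_graph t n)"
      unfolding is_copy_def by blast
    have "f ` e \<in> edges (turan3 (n - t))" if "e \<in> edges (F5S m)" for e
    proof -
      have "e \<subseteq> verts (F5S m)" using three_graph_F5S[OF assms(2)] that by (auto simp: three_graph_def)
      then have "f ` e \<inter> {n - t..<n} = {}" using f(2) empty by blast
      then show ?thesis using e[OF that] by (auto simp: extremal_graph_def)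
    qed
    then have "is_copy (F5S m) (edges (turan3 (n - t))) (U i)"
      unfolding is_copy_def using f by blast
    then show False using turan3_copy_free[OF assms(2)] by blast
  qed
  then have "\<forall>i. \<exists>x. i < t + 1 \<longrightarrow> x \<in> U i \<and> x \<in> {n - t..<n}" by blast
  then obtain g where g: "\<And>i. i < t + 1 \<Longrightarrow> g i \<in> U i \<and> g i \<in> {n - t..<n}" by metis
  have "inj_on g {..<t + 1}"
  proof (rule inj_onI, rule ccontr)
    fix i j assume "i \<in> {..<t + 1}" "j \<in> {..<t + 1}" "g i = g j" "i \<noteq> j"
    then show False using U g[of i] g[of j] unfolding packing_def by auto
  qed
  moreover have "g ` {..<t + 1} \<subseteq> {n - t..<n}" using g by blast
  ultimately have "card {..<t + 1} \<le> card {n - t..<n}" by (intro card_inj_on_le) auto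
  then show False using assms by simp
qed

section \<open>The extremal number\<close>

lemma upper_bound:
  fixes t m :: nat
  assumes "2 \<le> m"
  shows "\<exists>n0. \<forall>n\<ge>n0. \<forall>H :: 'a hypergraph. three_graph H \<and> card (verts H) = n \<and>
    \<not> contains_copy H (disjoint_copies (t + 1) (F5S m)) \<longrightarrow>
    card (edges H) \<le> card (edges (extremal_graph t n))"
proof -
  \<comment> \<open>A packed copy has \<open>3 * m + 1\<close> vertices with fewer than
    \<open>\<mu>\<close> n^2 bad edges each, so it costs at most n^2 / 672, below the n^2 / 16
    gained by a special vertex.\<close>
  define \<mu> :: real where "\<mu> = 1 / (672 * (3 * m + 1))"
  define K where "K = (t + 1) * (3 * m + 2)"
  have mu_bounds: "0 < \<mu>" "\<mu> \<le> 1 / 672" "(3 * m + 1) * \<mu> \<le> 1 / 16"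
    by (simp_all add: \<mu>_def field_simps)
  have \<eta>: "0 < \<mu>\<^sup>2 / 192" and \<delta>: "0 < \<mu> / 448" using mu_bounds(1) by simp_all
  obtain \<theta> n1 where \<theta>: "0 < \<theta>" and n1: "\<forall>V :: 'a set. \<forall>E U. finite V \<and> n1 \<le> card V \<and>
    (\<forall>X\<in>E. X \<subseteq> V \<and> card X = 3) \<and> U \<subseteq> V \<and> card U \<le> K \<and> \<not> (\<exists>P\<subseteq>V - U. is_copy (F5S m) E P) \<and>
    (1 / 27 - \<theta>) * card V ^ 3 \<le> card E \<longrightarrow>
    (\<exists>c :: 'a \<Rightarrow> nat. (\<forall>x. c x < 3) \<and> (1 / 27 - \<mu>\<^sup>2 / 192) * card V ^ 3 \<le> card {e \<in> E. inj_on c e})"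
    using stability[OF \<eta> assms, where 'a = 'a and K = K] by (elim exE conjE)
  obtain n2 where n2: "\<forall>V :: 'a set. \<forall>E W c d e. finite V \<and> n2 \<le> card V \<and> (\<forall>X\<in>E. card X = 3) \<and>
    {c, d, e} \<in> E \<and> {c, d, e} \<subseteq> V - W \<and> W \<subseteq> V \<and> card W \<le> K \<and>
    \<mu> / 448 * card V ^ 3 \<le> card {((a, b), x) \<in> (V \<times> V) \<times> V. {a, b, c} \<in> E \<and> {a, b, d} \<in> E \<and> {a, b, x} \<in> E} \<longrightarrow>
    (\<exists>U\<subseteq>V - W. is_copy (F5S m) E U)"
    using copy_from_common_links[OF \<delta> assms, where 'a = 'a and K = K] by (elim exE)
  obtain n3 :: nat where n3: "4 * real K / \<mu> \<le> n3" using real_arch_simple by blast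
  obtain n4 :: nat where n4: "(real t + 2) / (9 * \<theta>) \<le> n4" using real_arch_simple by blast
  show ?thesis
  \<comment> \<open>\<open>n1\<close> serves stability, \<open>n2\<close> the search for copies,
    \<open>n3\<close> the smallness of \<open>K\<close>, and \<open>n4\<close> the density, as it
    makes 3 (t + 2) n^2 at most 27 \<open>\<theta>\<close> n^3. The rest gives
    \<open>8 \<le> n - t\<close> and \<open>n \<le> 2 * (n - t)\<close>.\<close>
  proof (intro exI[of _ "n1 + n2 + n3 + n4 + 2 * t + 10"] allI impI, elim conjE)
    fix n and H :: "'a hypergraph"
    assume n: "n1 + n2 + n3 + n4 + 2 * t + 10 \<le> n" and H: "three_graph H"
      and card_V: "card (verts H) = n" and free: "\<not> contains_copy H (disjoint_copies (t + 1) (F5S m))"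
    define V where "V = verts H"
    define E where "E = edges H"
    have fin: "finite V" and edge: "\<And>X. X \<in> E \<Longrightarrow> X \<subseteq> V \<and> card X = 3" and cV: "card V = n"
      using H card_V by (auto simp: three_graph_def V_def E_def)
    have no_packing: "\<not> (\<exists>U. packing (F5S m) E (Suc t) U \<and> (\<forall>i<Suc t. U i \<subseteq> V))"
      using free by (simp add: contains_disjoint_copies_iff V_def E_def)
    show "card (edges H) \<le> card (edges (extremal_graph t n))"
    proof (rule ccontr)
      assume neg: "\<not> ?thesis"
      then have more: "card (edges (extremal_graph t n)) \<le> card E" by (simp add: E_def)
      have ext: "card (edges (extremal_graph t n)) + (n - t choose 3) = (n choose 3) + turan_size (n - t)"
        using n by (intro card_extremal_graph) simp
      moreover have "(n - t choose 3) \<le> (n choose 3)" by (rule binomial_right_mono) simp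
      ultimately have "turan_size (n - t) \<le> card E" using more by linarith
      moreover have "2 \<le> n - t" using n by linarith
      ultimately have "(real (n - t) - 2) ^ 3 / 27 \<le> card E"
        using turan_size_lower[of "n - t"] by linarith
      moreover have "(1 / 27 - \<theta>) * real n ^ 3 \<le> (real (n - t) - 2) ^ 3 / 27"
      proof -
        define a where "a = real t + 2"
        have a: "0 \<le> a" "a \<le> n" using n by (simp_all add: a_def)
        have "a / (9 * \<theta>) \<le> n" using n4 n by (simp add: a_def)
        then have "a \<le> 9 * \<theta> * n" using \<theta> by (simp add: field_simps)
        then have "3 * a * (real n)\<^sup>2 \<le> 3 * (9 * \<theta> * n) * (real n)\<^sup>2" by (intro mult_right_mono) auto
        moreover have "0 \<le> a\<^sup>2 * (3 * n - a)" using a by (intro mult_nonneg_nonneg) auto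
        moreover have "(real n - a) ^ 3 = real n ^ 3 - 3 * a * (real n)\<^sup>2 + a\<^sup>2 * (3 * n - a)"
          by (simp add: power2_eq_square power3_eq_cube algebra_simps)
        moreover have "3 * (9 * \<theta> * n) * (real n)\<^sup>2 = 27 * \<theta> * real n ^ 3"
          by (simp add: power2_eq_square power3_eq_cube)
        ultimately have "real n ^ 3 - 27 * \<theta> * real n ^ 3 \<le> (real n - a) ^ 3" by linarith
        moreover have "real (n - t) - 2 = real n - a" using n by (simp add: a_def of_nat_diff)
        ultimately show ?thesis by (simp add: left_diff_distrib)
      qed
      ultimately have dense: "(1 / 27 - \<theta>) * real n ^ 3 \<le> card E" by linarith
      \<comment> \<open>Only \<open>t + 1\<close> disjoint copies are excluded, not single ones.
        Stability is therefore applied outside a maximal packing of the whole graph, which has at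
        most \<open>t\<close> copies.\<close>
      obtain p U where p: "p \<le> t" and U: "packing (F5S m) E p U" "\<And>i. i < p \<Longrightarrow> U i \<subseteq> V"
        and max: "\<not> (\<exists>P\<subseteq>V - \<Union> (U ` {..<p}). is_copy (F5S m) E P)"
        using maximal_packing[OF no_packing] by metis
      define X where "X = \<Union> (U ` {..<p})"
      have XV: "X \<subseteq> V" using U(2) by (auto simp: X_def)
      have "card X \<le> p * (3 * m + 1)" unfolding X_def by (rule card_packing_union[OF U(1)])
      also have "\<dots> \<le> K" unfolding K_def using p by (intro mult_le_mono) auto
      finally have cX: "card X \<le> K" .
      obtain c0 :: "'a \<Rightarrow> nat" where c0: "\<forall>x. c0 x < 3"
        and tr0: "(1 / 27 - \<mu>\<^sup>2 / 192) * real n ^ 3 \<le> card {e \<in> E. inj_on c0 e}"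
      proof -
        have "finite V \<and> n1 \<le> card V \<and> (\<forall>X\<in>E. X \<subseteq> V \<and> card X = 3) \<and> X \<subseteq> V \<and> card X \<le> K \<and>
            \<not> (\<exists>P\<subseteq>V - X. is_copy (F5S m) E P) \<and> (1 / 27 - \<theta>) * card V ^ 3 \<le> card E"
          using fin edge XV cX max dense n by (simp add: cV X_def)
        then have "\<exists>c :: 'a \<Rightarrow> nat. (\<forall>x. c x < 3) \<and>
            (1 / 27 - \<mu>\<^sup>2 / 192) * card V ^ 3 \<le> card {e \<in> E. inj_on c e}"
          by (rule n1[rule_format])
        then show ?thesis using that by (auto simp: cV)
      qed
      have finE: "finite E" using finite_subset[of E "Pow V"] edge fin by auto
      have "(\<forall>x. c x < 3) \<longrightarrow> card {e \<in> E. inj_on c e} < Suc (card E)" for c :: "'a \<Rightarrow> nat"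
        using finE by (auto simp: less_Suc_eq_le intro!: card_mono)
      \<comment> \<open>The colouring from stability serves only to show that an optimal colouring
        has many transversal edges; the optimal one is used from here on.\<close>
      then obtain c :: "'a \<Rightarrow> nat" where c: "\<forall>x. c x < 3"
        and best: "\<And>c' :: 'a \<Rightarrow> nat. (\<forall>x. c' x < 3) \<Longrightarrow> card {e \<in> E. inj_on c' e} \<le> card {e \<in> E. inj_on c e}"
        using ex_has_greatest_nat[of "\<lambda>c. \<forall>x. c x < 3" c0 "\<lambda>c. card {e \<in> E. inj_on c e}" "Suc (card E)"] c0
        by blast
      interpret near_extremal V E c m K \<mu> "real n"
      proof (unfold_locales)
        show "(1 / 27 - \<mu>\<^sup>2 / 192) * real n ^ 3 \<le> card {e \<in> E. inj_on c e}"
          using tr0 best[of c0] c0 by (meson of_nat_le_iff order_trans)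
        have "4 * real K / \<mu> \<le> n" using n3 n by simp
        then show "4 * real K \<le> \<mu> * n" using mu_bounds(1) by (simp add: field_simps)
        show "\<exists>U\<subseteq>V - W. is_copy (F5S m) E U"
          if "{x, y, z} \<in> E" "{x, y, z} \<subseteq> V - W" "W \<subseteq> V" "card W \<le> K"
            "\<mu> / 448 * real n ^ 3 \<le> card {((a, b), u) \<in> (V \<times> V) \<times> V. {a, b, x} \<in> E \<and> {a, b, y} \<in> E \<and> {a, b, u} \<in> E}"
          for W x y z
        proof (rule n2[rule_format])
          show "finite V \<and> n2 \<le> card V \<and> (\<forall>X\<in>E. card X = 3) \<and> {x, y, z} \<in> E \<and> {x, y, z} \<subseteq> V - W \<and>
            W \<subseteq> V \<and> card W \<le> K \<and> \<mu> / 448 * card V ^ 3 \<le>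
            card {((a, b), u) \<in> (V \<times> V) \<times> V. {a, b, x} \<in> E \<and> {a, b, y} \<in> E \<and> {a, b, u} \<in> E}"
            using that fin edge n unfolding cV by (intro conjI) auto
        qed
      qed (use fin edge c mu_bounds assms cV n best in auto)
      have "\<not> (\<exists>U. packing (F5S m) E (t + 1) U \<and> (\<forall>i<t + 1. U i \<subseteq> V))" using no_packing by simp
      then obtain s where s: "s \<le> t" and bound: "real (card E) + (n - s choose 3) \<le>
          real (n choose 3) + turan_size (n - s) + real (t - s) * ((3 * m + 1) * \<mu> * (real n)\<^sup>2)"
        using edge_bound[of t] unfolding cV K_def by blast
      \<comment> \<open>For each of the \<open>t - s\<close> absent special vertices, the gain n^2 /
        16 outweighs the packing error in \<open>bound\<close>.\<close>
      have "real (n - t choose 3) - turan_size (n - t) + real (t - s) * ((real n)\<^sup>2 / 16)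
          \<le> real (n - s choose 3) - turan_size (n - s)"
        using n by (intro turan_deficit_mono s) auto
      moreover have "real (t - s) * ((3 * m + 1) * \<mu> * (real n)\<^sup>2) \<le> real (t - s) * ((real n)\<^sup>2 / 16)"
      proof (rule mult_left_mono)
        show "(3 * m + 1) * \<mu> * (real n)\<^sup>2 \<le> (real n)\<^sup>2 / 16"
          using mult_right_mono[OF mu_bounds(3), of "(real n)\<^sup>2"] by simp
      qed simp
      moreover have "real (card (edges (extremal_graph t n))) + (n - t choose 3) =
          real (n choose 3) + turan_size (n - t)"
        using ext by (metis of_nat_add)
      ultimately have "card E \<le> card (edges (extremal_graph t n))" using bound by linarith
      then show False using neg by (simp add: E_def)
    qed
  qed
qed

theorem theorem1p5:
  fixes t m :: nat
  assumes "t \<ge> 1" and "m \<ge> 2"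
  shows "\<exists>n0. \<forall>n\<ge>n0.
    \<not> contains_copy (extremal_graph t n) (disjoint_copies (t + 1) (F5S m)) \<and>
    (\<forall>H :: nat hypergraph.
       three_graph H \<and> card (verts H) = n \<and>
       \<not> contains_copy H (disjoint_copies (t + 1) (F5S m)) \<longrightarrow>
       card (edges H) \<le> card (edges (extremal_graph t n))) \<and>
    ex3 n (disjoint_copies (t + 1) (F5S m)) = card (edges (extremal_graph t n))"
proof -
  obtain n0 where n0: "\<forall>n\<ge>n0. \<forall>H :: nat hypergraph. three_graph H \<and> card (verts H) = n \<and>
    \<not> contains_copy H (disjoint_copies (t + 1) (F5S m)) \<longrightarrow>
    card (edges H) \<le> card (edges (extremal_graph t n))"
    using upper_bound[OF assms(2), where 'a = nat and t = t] by (elim exE)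
  show ?thesis
  proof (intro exI[of _ "max n0 t"] allI impI)
    fix n assume n: "max n0 t \<le> n"
    define A where "A = {card (edges H) | H :: nat hypergraph. three_graph H \<and> card (verts H) = n \<and>
      \<not> contains_copy H (disjoint_copies (t + 1) (F5S m))}"
    have free: "\<not> contains_copy (extremal_graph t n) (disjoint_copies (t + 1) (F5S m))"
      using n assms by (intro extremal_graph_free) auto
    have upper: "\<forall>H :: nat hypergraph. three_graph H \<and> card (verts H) = n \<and>
       \<not> contains_copy H (disjoint_copies (t + 1) (F5S m)) \<longrightarrow>
       card (edges H) \<le> card (edges (extremal_graph t n))"
      using n0 n by simp
    have "Max A = card (edges (extremal_graph t n))"
    proof (rule Max_eqI)
      show "x \<le> card (edges (extremal_graph t n))" if "x \<in> A" for x
        using that upper by (auto simp: A_def)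
      then show "finite A" by (meson atMost_iff finite_atMost finite_subset subsetI)
      show "card (edges (extremal_graph t n)) \<in> A"
        unfolding A_def using free three_graph_extremal_graph card_verts_extremal_graph by blast
    qed
    then show "\<not> contains_copy (extremal_graph t n) (disjoint_copies (t + 1) (F5S m)) \<and>
      (\<forall>H :: nat hypergraph. three_graph H \<and> card (verts H) = n \<and>
         \<not> contains_copy H (disjoint_copies (t + 1) (F5S m)) \<longrightarrow>
         card (edges H) \<le> card (edges (extremal_graph t n))) \<and>
      ex3 n (disjoint_copies (t + 1) (F5S m)) = card (edges (extremal_graph t n))"
      using free upper by (simp add: ex3_def A_def)
  qed
qed

end
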